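(* Every D3-reducible graph $G$ is planar, and every triangle (3-cycle) in $G$ is a face of its unique planar embedding.
   Context: All graphs are finite and simple. The D3 reductions are the following two operations on a graph $G$. (D3a) Let $p,q,r$ be three vertices of degree three that induce a triangle in $G$ and whose neighbors outside $\{p,q,r\}$ are three distinct vertices; replace $p,q,r$ by a single new vertex adjacent to exactly those three outside neighbors. (D3b) Let $p,q,r$ be three vertices of degree three that induce a path with middle vertex $q$, and suppose there is a single vertex $s$ adjacent to all three of $p,q,r$; delete $q$ and add a new edge from $p$ to $r$. A graph is D3-reducible if it can be transformed into a graph isomorphic to $K_4$ by a finite sequence of D3 reductions. (D3-reducible graphs are 3-vertex-connected, so a planar embedding, if it exists, is unique up to the choice of outer face; its faces are well defined.) *)

theory Defs
  imports "HOL-Analysis.Analysis"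
begin

type_synonym 'a ugraph = "'a set \<times> 'a set set"

abbreviation verts :: "'a ugraph \<Rightarrow> 'a set" where
  "verts G \<equiv> fst G"

abbreviation edges :: "'a ugraph \<Rightarrow> 'a set set" where
  "edges G \<equiv> snd G"

definition simple_graph :: "'a ugraph \<Rightarrow> bool" where
  "simple_graph G \<longleftrightarrow> finite (verts G) \<and> (\<forall>e\<in>edges G. e \<subseteq> verts G \<and> card e = 2)"

definition adj :: "'a ugraph \<Rightarrow> 'a \<Rightarrow> 'a \<Rightarrow> bool" where
  "adj G u v \<longleftrightarrow> {u, v} \<in> edges G"

definition vdegree :: "'a ugraph \<Rightarrow> 'a \<Rightarrow> nat" where
  "vdegree G v = card {u. adj G v u}"

definition is_triangle :: "'a ugraph \<Rightarrow> 'a \<Rightarrow> 'a \<Rightarrow> 'a \<Rightarrow> bool" where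
  "is_triangle G a b c \<longleftrightarrow> distinct [a, b, c] \<and> adj G a b \<and> adj G b c \<and> adj G a c"

definition graph_iso :: "'a ugraph \<Rightarrow> 'b ugraph \<Rightarrow> bool" where
  "graph_iso G H \<longleftrightarrow>
     (\<exists>f. bij_betw f (verts G) (verts H) \<and>
          (\<forall>u\<in>verts G. \<forall>v\<in>verts G. adj G u v \<longleftrightarrow> adj H (f u) (f v)))"

definition K4 :: "nat ugraph" where
  "K4 = ({..<4}, {e. e \<subseteq> {..<4} \<and> card e = 2})"

text \<open>
  In \<open>D3a\<close>, the new vertex \<open>w\<close> need only differ from the vertices that remain: it may reuse one of
  the names \<open>p\<close>, \<open>q\<close>, \<open>r\<close>. Up to isomorphism this is the same as taking \<open>w\<close> outside
  \<open>verts G\<close>, but it also works when no further element of the type \<open>'a\<close> is available.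
\<close>

inductive D3_step :: "'a ugraph \<Rightarrow> 'a ugraph \<Rightarrow> bool" where
  D3a: "D3_step G
          (insert w (verts G - {p, q, r}),
           {e \<in> edges G. e \<inter> {p, q, r} = {}} \<union> {{w, a}, {w, b}, {w, c}})"
  if "is_triangle G p q r"
     "vdegree G p = 3" "vdegree G q = 3" "vdegree G r = 3"
     "adj G p a" "adj G q b" "adj G r c"
     "a \<notin> {p, q, r}" "b \<notin> {p, q, r}" "c \<notin> {p, q, r}"
     "distinct [a, b, c]"
     "w \<notin> verts G - {p, q, r}"
| D3b: "D3_step G
          (verts G - {q}, {e \<in> edges G. q \<notin> e} \<union> {{p, r}})"
  if "distinct [p, q, r]" "adj G p q" "adj G q r" "\<not> adj G p r"
     "vdegree G p = 3" "vdegree G q = 3" "vdegree G r = 3"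
     "adj G s p" "adj G s q" "adj G s r"

definition D3_reducible :: "'a ugraph \<Rightarrow> bool" where
  "D3_reducible G \<longleftrightarrow> (\<exists>H. D3_step\<^sup>*\<^sup>* G H \<and> graph_iso H K4)"

text \<open>
  Topological embedding in the plane \<open>complex\<close>: \<open>pos\<close> places the vertices and \<open>\<gamma> e\<close> is a simple
  arc drawing the edge \<open>e\<close>; its orientation is irrelevant.
\<close>

definition planar_embedding ::
    "'a ugraph \<Rightarrow> ('a \<Rightarrow> complex) \<Rightarrow> ('a set \<Rightarrow> real \<Rightarrow> complex) \<Rightarrow> bool" where
  "planar_embedding G pos \<gamma> \<longleftrightarrow>
     inj_on pos (verts G) \<and>
     (\<forall>e\<in>edges G. arc (\<gamma> e) \<and> {pathstart (\<gamma> e), pathfinish (\<gamma> e)} = pos ` e) \<and>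
     (\<forall>e\<in>edges G. \<forall>v\<in>verts G. pos v \<in> path_image (\<gamma> e) \<longrightarrow> v \<in> e) \<and>
     (\<forall>e\<in>edges G. \<forall>e'\<in>edges G. e \<noteq> e' \<longrightarrow>
        path_image (\<gamma> e) \<inter> path_image (\<gamma> e') \<subseteq> pos ` (e \<inter> e'))"

definition planar :: "'a ugraph \<Rightarrow> bool" where
  "planar G \<longleftrightarrow> (\<exists>pos \<gamma>. planar_embedding G pos \<gamma>)"

definition drawing ::
    "'a ugraph \<Rightarrow> ('a \<Rightarrow> complex) \<Rightarrow> ('a set \<Rightarrow> real \<Rightarrow> complex) \<Rightarrow> complex set" where
  "drawing G pos \<gamma> = pos ` verts G \<union> (\<Union>e\<in>edges G. path_image (\<gamma> e))"

text \<open>The unbounded (outer) face is included.\<close>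

definition faces ::
    "'a ugraph \<Rightarrow> ('a \<Rightarrow> complex) \<Rightarrow> ('a set \<Rightarrow> real \<Rightarrow> complex) \<Rightarrow> complex set set" where
  "faces G pos \<gamma> = components (- drawing G pos \<gamma>)"

text \<open>A triangle ``is a face'' if the closed curve drawing it is the whole boundary of some face.\<close>

definition triangle_is_face ::
    "'a ugraph \<Rightarrow> ('a \<Rightarrow> complex) \<Rightarrow> ('a set \<Rightarrow> real \<Rightarrow> complex) \<Rightarrow> 'a \<Rightarrow> 'a \<Rightarrow> 'a \<Rightarrow> bool" where
  "triangle_is_face G pos \<gamma> a b c \<longleftrightarrow>
     (\<exists>F\<in>faces G pos \<gamma>.
        frontier F = path_image (\<gamma> {a, b}) \<union> path_image (\<gamma> {b, c}) \<union> path_image (\<gamma> {a, c}))"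

end

theory Submission
  imports Defs
begin

text \<open>
  \<^emph>\<open>Faces.\<close> Undoing a reduction preserves the property that deleting any clique leaves a connected
  graph. Hence everything off a triangle lies on one side of the Jordan curve drawing it, and the other
  side is a face.

  \<^emph>\<open>Planarity.\<close> Unless \<open>G\<close> is complete on four vertices, its clique complex has a linear realisation
  in the plane; in particular the triangles bound regions free of the rest of the drawing. Undoing
  \<open>D3b\<close> bisects an edge of such a triangle and joins the midpoint to the opposite corner; undoing \<open>D3a\<close>
  inscribes a triangle in a small circle around the vertex. In the complete graph on four vertices only
  the outer triangle is not realised, and it can be chosen to be one that the first step destroys.
\<close>

section \<open>Cliques and connectivity\<close>

text \<open>A mere drawing of \<open>H\<close> is too weak an induction hypothesis: undoing
  \<open>D3b\<close> needs the inside of the triangle \<open>{p, r, s}\<close> to be free of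
  everything else, and a topological drawing does not record this. Hence the stronger invariant on
  the clique complex. Its exception is forced: four points of the plane are affinely dependent, so a
  clique of four vertices has no linear realisation. Injectivity of one map in barycentric
  coordinates encodes the whole invariant, so undoing a step becomes a piecewise linear map of
  weights whose injectivity is mostly algebra; topology enters only in the choice of a small radius.
  The faces, in contrast, belong to an arbitrary topological embedding, about which only the
  combinatorics of \<open>G\<close> and the Jordan curve theorem say anything; this is why the other
  induction carries connectivity.\<close>

definition clique :: "'a ugraph \<Rightarrow> 'a set \<Rightarrow> bool" where
  "clique G T \<longleftrightarrow> T \<subseteq> verts G \<and> (\<forall>u\<in>T. \<forall>v\<in>T. u \<noteq> v \<longrightarrow> adj G u v)"

text \<open>Stated through two-colourings, which transfer along the reductions more easily than paths.\<close>

definition connected_on :: "'a ugraph \<Rightarrow> 'a set \<Rightarrow> bool" where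
  "connected_on G S \<longleftrightarrow>
     (\<forall>P :: 'a \<Rightarrow> bool. (\<forall>x\<in>S. \<forall>y\<in>S. adj G x y \<longrightarrow> P x = P y) \<longrightarrow> (\<forall>x\<in>S. \<forall>y\<in>S. P x = P y))"

text \<open>Arbitrary cliques rather than triangles: a triangle of \<open>G\<close> may correspond
  to an edge of \<open>H\<close> or, for \<open>{p, q, r}\<close>, to the single vertex
  \<open>w\<close>, so the induction passes to smaller cliques.\<close>

definition clique_connected :: "'a ugraph \<Rightarrow> bool" where
  "clique_connected G \<longleftrightarrow> (\<forall>T. clique G T \<longrightarrow> connected_on G (verts G - T))"

lemma clique_subset: "clique G B \<Longrightarrow> A \<subseteq> B \<Longrightarrow> clique G A"
  by (auto simp: clique_def)

lemma connected_onI: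
  assumes "\<And>(P :: 'a \<Rightarrow> bool) x y. (\<And>x y. x \<in> S \<Longrightarrow> y \<in> S \<Longrightarrow> adj G x y \<Longrightarrow> P x = P y) \<Longrightarrow> x \<in> S \<Longrightarrow> y \<in> S \<Longrightarrow> P x = P y"
  shows "connected_on G S"
  unfolding connected_on_def
proof (intro allI impI ballI)
  fix P :: "'a \<Rightarrow> bool" and x y
  assume "\<forall>x\<in>S. \<forall>y\<in>S. adj G x y \<longrightarrow> P x = P y" "x \<in> S" "y \<in> S"
  then show "P x = P y" using assms[of P x y] by blast
qed

lemma connected_onD:
  fixes P :: "'a \<Rightarrow> bool"
  assumes "connected_on G S" "\<And>x y. x \<in> S \<Longrightarrow> y \<in> S \<Longrightarrow> adj G x y \<Longrightarrow> P x = P y" "x \<in> S" "y \<in> S"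
  shows "P x = P y"
proof -
  have "\<forall>x\<in>S. \<forall>y\<in>S. adj G x y \<longrightarrow> P x = P y"
    using assms(2) by simp
  with assms(1)[unfolded connected_on_def, THEN spec, of P] have "\<forall>x\<in>S. \<forall>y\<in>S. P x = P y"
    by (rule mp)
  then show ?thesis using assms(3,4) by blast
qed

lemma adj_commute: "adj G u v \<longleftrightarrow> adj G v u"
  by (simp add: adj_def insert_commute)

lemma connected_on_insert:
  assumes "connected_on G S" "y \<in> S" "adj G x y"
  shows "connected_on G (insert x S)"
proof (rule connected_onI)
  fix P :: "'a \<Rightarrow> bool" and u v
  assume P: "\<And>x' y. x' \<in> insert x S \<Longrightarrow> y \<in> insert x S \<Longrightarrow> adj G x' y \<Longrightarrow> P x' = P y"
    and uv: "u \<in> insert x S" "v \<in> insert x S"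
  have const: "P z = P y" if "z \<in> S" for z
    by (rule connected_onD[where P = P, OF assms(1) _ that assms(2)]) (rule P; simp)
  moreover have "P x = P y"
    using P[of x y] assms by simp
  ultimately have "P z = P y" if "z \<in> insert x S" for z
    using that by auto
  then show "P u = P v" using uv by simp
qed

lemma connected_on_cong:
  assumes "connected_on H S" "\<And>x y. x \<in> S \<Longrightarrow> y \<in> S \<Longrightarrow> adj H x y \<Longrightarrow> adj G x y"
  shows "connected_on G S"
proof (rule connected_onI)
  fix P :: "'a \<Rightarrow> bool" and x y
  assume P: "\<And>x y. x \<in> S \<Longrightarrow> y \<in> S \<Longrightarrow> adj G x y \<Longrightarrow> P x = P y"
    and xy: "x \<in> S" "y \<in> S"
  show "P x = P y"
    by (rule connected_onD[where P = P, OF assms(1) _ xy]) (rule P; simp add: assms(2))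
qed

lemma simple_graph_adjD:
  assumes "simple_graph G" "adj G u v"
  shows "u \<in> verts G" "v \<in> verts G" "u \<noteq> v"
proof -
  have "{u, v} \<subseteq> verts G" "card {u, v} = 2"
    using assms by (auto simp: simple_graph_def adj_def)
  then show "u \<in> verts G" "v \<in> verts G" "u \<noteq> v"
    by auto
qed

lemma simple_graph_edgeE:
  assumes "simple_graph G" "e \<in> edges G"
  obtains u v where "e = {u, v}" "u \<noteq> v" "adj G u v"
proof -
  have "card e = 2" using assms by (simp add: simple_graph_def)
  then show thesis using that assms(2) by (auto simp: card_2_iff adj_def)
qed

text \<open>Three known neighbours exhaust a neighbourhood of size three. An infinite set has
  cardinality 0, so degree 3 also yields finiteness.\<close>

lemma vdegree_3_adj_iff:
  assumes "vdegree G v = 3" "adj G v x" "adj G v y" "adj G v z" "distinct [x, y, z]"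
  shows "adj G v u \<longleftrightarrow> u \<in> {x, y, z}"
proof -
  have "finite {u. adj G v u}"
    using assms(1) unfolding vdegree_def by (metis card.infinite zero_neq_numeral)
  moreover have "{x, y, z} \<subseteq> {u. adj G v u}" "card {x, y, z} = 3"
    using assms by auto
  ultimately have "{x, y, z} = {u. adj G v u}"
    using assms(1) unfolding vdegree_def by (intro card_subset_eq) auto
  then show ?thesis by blast
qed

section \<open>The reductions\<close>

locale D3a_reduction =
  fixes G H :: "'a ugraph" and p q r a b c w :: 'a
  assumes simple: "simple_graph G"
    and tri: "is_triangle G p q r"
    and deg: "vdegree G p = 3" "vdegree G q = 3" "vdegree G r = 3"
    and out: "adj G p a" "adj G q b" "adj G r c"
    and notin: "a \<notin> {p, q, r}" "b \<notin> {p, q, r}" "c \<notin> {p, q, r}"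
    and dist_abc: "distinct [a, b, c]"
    and w: "w \<notin> verts G - {p, q, r}"
    and H: "H = (insert w (verts G - {p, q, r}),
                {e \<in> edges G. e \<inter> {p, q, r} = {}} \<union> {{w, a}, {w, b}, {w, c}})"
begin

lemma distinct_pqr: "p \<noteq> q" "q \<noteq> r" "p \<noteq> r"
  using tri by (auto simp: is_triangle_def)

lemma adj_pqr: "adj G p q" "adj G q r" "adj G p r"
  using tri by (auto simp: is_triangle_def)

lemma adj_G_iff:
  "adj G p u \<longleftrightarrow> u \<in> {q, r, a}" "adj G q u \<longleftrightarrow> u \<in> {p, r, b}" "adj G r u \<longleftrightarrow> u \<in> {p, q, c}"
proof -
  have "adj G q p" "adj G r p" "adj G r q"
    using adj_pqr by (simp_all add: adj_commute)
  then show "adj G p u \<longleftrightarrow> u \<in> {q, r, a}" "adj G q u \<longleftrightarrow> u \<in> {p, r, b}" "adj G r u \<longleftrightarrow> u \<in> {p, q, c}"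
    using distinct_pqr notin deg adj_pqr out
    by (intro vdegree_3_adj_iff; force)+
qed

lemma verts_H: "verts H = insert w (verts G - {p, q, r})"
  by (simp add: H)

lemma in_verts: "p \<in> verts G" "q \<in> verts G" "r \<in> verts G" "a \<in> verts G" "b \<in> verts G" "c \<in> verts G"
  using simple_graph_adjD[OF simple] adj_pqr out by blast+

lemma verts_G: "verts G = (verts H - {w}) \<union> {p, q, r}"
  using in_verts w by (auto simp: verts_H)

lemma w_neq: "w \<noteq> a" "w \<noteq> b" "w \<noteq> c"
  using w in_verts notin by auto

lemma adj_H_iff:
  "adj H u v \<longleftrightarrow> adj G u v \<and> u \<notin> {p, q, r} \<and> v \<notin> {p, q, r}
     \<or> {u, v} = {w, a} \<or> {u, v} = {w, b} \<or> {u, v} = {w, c}"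
proof -
  have "{u, v} \<inter> {p, q, r} = {} \<longleftrightarrow> u \<notin> {p, q, r} \<and> v \<notin> {p, q, r}" by blast
  then show ?thesis
    by (simp only: H adj_def snd_conv Un_iff mem_Collect_eq insert_iff empty_iff) argo
qed

lemma clique_edges: "clique H {w, a}" "clique H {w, b}" "clique H {w, c}"
proof -
  have "adj H w a" "adj H w b" "adj H w c"
    by (simp_all add: adj_H_iff)
  then show "clique H {w, a}" "clique H {w, b}" "clique H {w, c}"
    using in_verts notin by (simp_all add: clique_def verts_H adj_commute)
qed

lemma simple_H: "simple_graph H"
proof -
  have "finite (verts H)"
    using simple by (auto simp: verts_H simple_graph_def)
  moreover have "e \<subseteq> verts H \<and> card e = 2" if "e \<in> edges H" for e
    using that simple w_neq in_verts notin by (auto simp: H simple_graph_def)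
  ultimately show ?thesis by (auto simp: simple_graph_def)
qed

text \<open>Each corner sees only the other corners and one outside vertex. As \<open>a\<close>,
  \<open>b\<close>, \<open>c\<close> are distinct, an outside vertex sees only one corner, so it
  shares a clique with no second one.\<close>

lemma clique_meets:
  assumes "clique G A" "A \<inter> {p, q, r} \<noteq> {}"
  shows "A \<subseteq> {p, q, r} \<or> A \<subseteq> {p, a} \<or> A \<subseteq> {q, b} \<or> A \<subseteq> {r, c}"
proof -
  have sub: "A \<subseteq> insert u {v. adj G u v}" if "u \<in> A" for u
    using assms(1) that by (auto simp: clique_def)
  have p: "A \<subseteq> {p, q, r, a}" if "p \<in> A"
    using sub[OF that] by (auto simp: adj_G_iff)
  have q: "A \<subseteq> {p, q, r, b}" if "q \<in> A"
    using sub[OF that] by (auto simp: adj_G_iff)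
  have r: "A \<subseteq> {p, q, r, c}" if "r \<in> A"
    using sub[OF that] by (auto simp: adj_G_iff)
  consider "p \<in> A" | "q \<in> A" | "r \<in> A" using assms(2) by auto
  then show ?thesis
  proof cases
    case 1
    show ?thesis
    proof (cases "a \<in> A")
      case True
      have "q \<notin> A" using q[THEN subsetD, OF _ True] notin dist_abc by auto
      moreover have "r \<notin> A" using r[THEN subsetD, OF _ True] notin dist_abc by auto
      ultimately show ?thesis using p[OF 1] by blast
    next
      case False
      then show ?thesis using p[OF 1] by blast
    qed
  next
    case 2
    show ?thesis
    proof (cases "b \<in> A")
      case True
      have "p \<notin> A" using p[THEN subsetD, OF _ True] notin dist_abc by auto
      moreover have "r \<notin> A" using r[THEN subsetD, OF _ True] notin dist_abc by auto
      ultimately show ?thesis using q[OF 2] by blast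
    next
      case False
      then show ?thesis using q[OF 2] by blast
    qed
  next
    case 3
    show ?thesis
    proof (cases "c \<in> A")
      case True
      have "p \<notin> A" using p[THEN subsetD, OF _ True] notin dist_abc by auto
      moreover have "q \<notin> A" using q[THEN subsetD, OF _ True] notin dist_abc by auto
      ultimately show ?thesis using r[OF 3] by blast
    next
      case False
      then show ?thesis using r[OF 3] by blast
    qed
  qed
qed

lemma clique_avoids:
  assumes "clique G A" "A \<inter> {p, q, r} = {}"
  shows "clique H A" "w \<notin> A"
proof -
  have sub: "A \<subseteq> verts G - {p, q, r}"
    using assms by (auto simp: clique_def)
  then show "w \<notin> A" using w by blast
  have "adj H u v" if "u \<in> A" "v \<in> A" "u \<noteq> v" for u v
    using that assms(1) sub unfolding adj_H_iff clique_def by blast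
  then show "clique H A"
    using sub unfolding clique_def verts_H by blast
qed

text \<open>Contract the corners to \<open>w\<close>. A clique \<open>T\<close> off the triangle
  stays a clique of \<open>H\<close>; one that meets it shrinks to a part of an edge at
  \<open>w\<close>, and the corners that survive are attached again through their outside
  neighbours.\<close>

lemma clique_connected_step:
  assumes "clique_connected H"
  shows "clique_connected G"
  unfolding clique_connected_def
proof (intro allI impI)
  fix T assume T: "clique G T"
  show "connected_on G (verts G - T)"
  proof (cases "T \<inter> {p, q, r} = {}")
    case True
    from clique_avoids[OF T True] have wT: "w \<notin> T" and c: "connected_on H (verts H - T)"
      using assms by (auto simp: clique_connected_def)
    show ?thesis
    proof (rule connected_onI)
      fix P :: "'a \<Rightarrow> bool" and x y
      assume P: "\<And>x y. x \<in> verts G - T \<Longrightarrow> y \<in> verts G - T \<Longrightarrow> adj G x y \<Longrightarrow> P x = P y"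
        and xy: "x \<in> verts G - T" "y \<in> verts G - T"
      \<comment> \<open>The corners are pairwise adjacent and all present, so they share one colour,
        which \<open>w\<close> inherits. An update is used because \<open>w\<close> may be one of
        the corners.\<close>
      define P' where "P' = P(w := P p)"
      have pqr: "P q = P p" "P r = P p"
        using P[of p q] P[of p r] adj_pqr in_verts True by auto
      have abc: "a \<notin> T \<Longrightarrow> P a = P p" "b \<notin> T \<Longrightarrow> P b = P p" "c \<notin> T \<Longrightarrow> P c = P p"
        using P[of p a] P[of q b] P[of r c] pqr out in_verts True by auto
      have P': "P' u = P' v" if "u \<in> verts H - T" "v \<in> verts H - T" "adj H u v" for u v
        using that(3) unfolding adj_H_iff
      proof (elim disjE)
        assume *: "adj G u v \<and> u \<notin> {p, q, r} \<and> v \<notin> {p, q, r}"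
        then have "u \<in> verts G" "v \<in> verts G" using simple_graph_adjD[OF simple] by blast+
        moreover from this * have "u \<noteq> w" "v \<noteq> w" using w by blast+
        ultimately show ?thesis using P[of u v] that * by (auto simp: P'_def)
      qed (use that abc w_neq in \<open>auto simp: P'_def doubleton_eq_iff\<close>)
      have eq: "P' u = P' w" if "u \<in> verts H - T" for u
        by (rule connected_onD[where P = P', OF c P' that]) (use wT in \<open>auto simp: verts_H\<close>)
      have "P z = P p" if "z \<in> verts G - T" for z
      proof (cases "z \<in> {p, q, r}")
        case True
        then show ?thesis using pqr by auto
      next
        case False
        then have "z \<in> verts H - T" "z \<noteq> w" using that w by (auto simp: verts_H)
        then show ?thesis using eq[of z] by (simp add: P'_def)
      qed
      then show "P x = P y" using xy by simp
    qed
  next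
    case False
    define S where "S = verts G - T - {p, q, r}"
    \<comment> \<open>Deleting \<open>T'\<close> from \<open>H\<close> leaves exactly
      \<open>S\<close>, and without \<open>w\<close> the two graphs have the same edges on
      \<open>S\<close>.\<close>
    define T' where "T' = insert w (T - {p, q, r})"
    have "T' \<subseteq> {w, a} \<or> T' \<subseteq> {w, b} \<or> T' \<subseteq> {w, c}"
      using clique_meets[OF T False] unfolding T'_def by blast
    then have T': "clique H T'"
      using clique_edges clique_subset by blast
    have "verts H - T' = S" using w by (auto simp: S_def T'_def verts_H)
    then have "connected_on H S"
      using assms T' by (auto simp: clique_connected_def)
    then have S: "connected_on G S"
      by (rule connected_on_cong) (use w in \<open>auto simp: S_def adj_H_iff doubleton_eq_iff\<close>)
    \<comment> \<open>An outside neighbour is deleted only together with its corner, so every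
      surviving corner keeps an edge into \<open>S\<close>.\<close>
    have "p \<in> T" if "a \<in> T"
      using clique_meets[OF T False] False that notin(1) dist_abc by auto
    moreover have "q \<in> T" if "b \<in> T"
      using clique_meets[OF T False] False that notin(2) dist_abc by auto
    moreover have "r \<in> T" if "c \<in> T"
      using clique_meets[OF T False] False that notin(3) dist_abc by auto
    ultimately have abc: "a \<in> S \<or> p \<in> T" "b \<in> S \<or> q \<in> T" "c \<in> S \<or> r \<in> T"
      using in_verts notin by (auto simp: S_def)
    have attach: "connected_on G (U \<union> S)" if "finite U" "U \<subseteq> {p, q, r} - T" for U
      using that
    proof (induction U)
      case (insert x U)
      have "\<exists>y\<in>S. adj G x y"
        using insert.prems out abc by auto
      then show ?case
        using connected_on_insert[of G "U \<union> S" _ x] insert by auto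
    qed (simp add: S)
    have "verts G - T = ({p, q, r} - T) \<union> S"
      using in_verts by (auto simp: S_def)
    then show ?thesis using attach[of "{p, q, r} - T"] by simp
  qed
qed

end

section \<open>Undoing \<open>D3b\<close>: an edge of a triangle is bisected\<close>

locale D3b_reduction =
  fixes G H :: "'a ugraph" and p q r s :: 'a
  assumes simple: "simple_graph G"
    and dist_pqr: "distinct [p, q, r]"
    and path: "adj G p q" "adj G q r" "\<not> adj G p r"
    and deg: "vdegree G p = 3" "vdegree G q = 3" "vdegree G r = 3"
    and hub: "adj G s p" "adj G s q" "adj G s r"
    and H: "H = (verts G - {q}, {e \<in> edges G. q \<notin> e} \<union> {{p, r}})"
begin

lemma neqs: "p \<noteq> q" "q \<noteq> r" "p \<noteq> r" "s \<noteq> p" "s \<noteq> q" "s \<noteq> r"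
  using dist_pqr simple_graph_adjD(3)[OF simple] hub by auto

lemma in_verts: "p \<in> verts G" "q \<in> verts G" "r \<in> verts G" "s \<in> verts G"
  using simple_graph_adjD[OF simple] path hub by blast+

lemma adj_q_iff: "adj G q u \<longleftrightarrow> u \<in> {p, r, s}"
  using vdegree_3_adj_iff[OF deg(2), of p r s u] path hub neqs by (auto simp: adj_commute)

lemma verts_H: "verts H = verts G - {q}"
  by (simp add: H)

lemma adj_H_iff: "adj H u v \<longleftrightarrow> adj G u v \<and> u \<noteq> q \<and> v \<noteq> q \<or> {u, v} = {p, r}"
  by (simp only: H adj_def snd_conv Un_iff mem_Collect_eq insert_iff empty_iff) blast

lemma simple_H: "simple_graph H"
proof -
  have "finite (verts H)"
    using simple by (auto simp: verts_H simple_graph_def)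
  moreover have "e \<subseteq> verts H \<and> card e = 2" if "e \<in> edges H" for e
    using that simple neqs in_verts by (auto simp: H simple_graph_def)
  ultimately show ?thesis by (auto simp: simple_graph_def)
qed

text \<open>Needed twice: it keeps \<open>p\<close> attached when only \<open>q\<close> and perhaps
  \<open>s\<close> are deleted, and it is the fourth vertex when \<open>H\<close> is
  complete.\<close>

lemma third_neighbour:
  obtains x where "adj G p x" "x \<in> verts G" "x \<notin> {p, q, r, s}"
proof -
  have "finite {u. adj G p u}"
    using deg(1) unfolding vdegree_def by (metis card.infinite zero_neq_numeral)
  moreover have "card {q, s} < card {u. adj G p u}"
    using deg(1) neqs by (simp add: vdegree_def)
  ultimately obtain x where "adj G p x" "x \<notin> {q, s}"
    by (metis card_mono finite.emptyI finite.insertI leD mem_Collect_eq subsetI)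
  then show thesis
    using that[of x] simple_graph_adjD[OF simple \<open>adj G p x\<close>] path(3) by auto
qed

text \<open>These are the two halves into which the triangle \<open>{p, r, s}\<close> of
  \<open>H\<close> is cut.\<close>

lemma clique_with_q:
  assumes "clique G A" "q \<in> A"
  shows "A \<subseteq> {p, q, s} \<or> A \<subseteq> {q, r, s}"
proof -
  have adj: "adj G u v" if "u \<in> A" "v \<in> A" "u \<noteq> v" for u v
    using assms(1) that by (auto simp: clique_def)
  have "x \<in> {q, p, r, s}" if "x \<in> A" for x
    using adj[OF assms(2) that] adj_q_iff by auto
  moreover have "\<not> (p \<in> A \<and> r \<in> A)"
    using adj path(3) neqs by auto
  ultimately show ?thesis by blast
qed

lemma clique_not_pr: "clique G A \<Longrightarrow> p \<in> A \<Longrightarrow> r \<in> A \<Longrightarrow> False"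
  using path(3) neqs by (auto simp: clique_def)

lemma clique_without_q:
  assumes "clique G A" "q \<notin> A"
  shows "clique H A"
proof -
  have "adj H u v" if "u \<in> A" "v \<in> A" "u \<noteq> v" for u v
    using that assms unfolding adj_H_iff clique_def by blast
  then show ?thesis
    using assms unfolding clique_def verts_H by blast
qed

lemma clique_prs: "clique H {p, r, s}"
proof -
  have "adj H s p" "adj H s r" "adj H p r"
    using neqs hub by (simp_all add: adj_H_iff)
  then show ?thesis
    using neqs in_verts by (simp add: clique_def verts_H adj_commute)
qed

text \<open>While \<open>q\<close> is present, the path through it does the work of the edge
  \<open>{p, r}\<close>. When \<open>q\<close> is deleted, that edge has to be removed on the side
  of \<open>H\<close> as well, by deleting one of its ends.\<close>

lemma clique_connected_step:
  assumes "clique_connected H"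
  shows "clique_connected G"
  unfolding clique_connected_def
proof (intro allI impI)
  \<comment> \<open>\<open>{p, r}\<close> is the only edge of \<open>H\<close> that \<open>G\<close>
    lacks, and it disappears with either end.\<close>
  have conn: "connected_on G (verts H - A)" if "clique H A" "p \<in> A \<or> r \<in> A" for A
  proof (rule connected_on_cong)
    show "connected_on H (verts H - A)" using that assms by (simp add: clique_connected_def)
  qed (use that in \<open>auto simp: adj_H_iff doubleton_eq_iff\<close>)
  fix T assume T: "clique G T"
  show "connected_on G (verts G - T)"
  proof (cases "q \<in> T")
    case True
    show ?thesis
    proof (cases "p \<in> T \<or> r \<in> T")
      case pr: True
      have "T - {q} \<subseteq> {p, s} \<or> T - {q} \<subseteq> {r, s}"
        using clique_with_q[OF T True] by auto
      then have "clique H (T - {q})"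
        using clique_prs clique_subset by blast
      moreover have "verts G - T = verts H - (T - {q})"
        using True by (auto simp: verts_H)
      ultimately show ?thesis using conn[of "T - {q}"] pr neqs by auto
    next
      case False
      obtain x where x: "adj G p x" "x \<in> verts G" "x \<notin> {p, q, r, s}"
        by (rule third_neighbour)
      \<comment> \<open>Here \<open>T\<close> lies in \<open>{q, s}\<close>. Trading
        \<open>q\<close> for \<open>p\<close> makes \<open>conn\<close> applicable; \<open>p\<close>
        is then put back through its neighbour \<open>x\<close>.\<close>
      define T' where "T' = insert p (T - {q})"
      have "T' \<subseteq> {p, s}"
        using clique_with_q[OF T True] False by (auto simp: T'_def)
      then have "clique H T'"
        using clique_prs clique_subset by blast
      then have c: "connected_on G (verts H - T')" using conn[of T'] by (auto simp: T'_def)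
      have "verts G - T = insert p (verts H - T')"
        using True False in_verts neqs by (auto simp: verts_H T'_def)
      moreover have "x \<in> verts H - T'" using \<open>T' \<subseteq> {p, s}\<close> x by (auto simp: verts_H)
      ultimately show ?thesis using connected_on_insert[OF c _ x(1)] by simp
    qed
  next
    case False
    show ?thesis
    proof (rule connected_onI)
      fix P :: "'a \<Rightarrow> bool" and x y
      assume P: "\<And>x y. x \<in> verts G - T \<Longrightarrow> y \<in> verts G - T \<Longrightarrow> adj G x y \<Longrightarrow> P x = P y"
        and xy: "x \<in> verts G - T" "y \<in> verts G - T"
      have pq: "p \<notin> T \<Longrightarrow> P p = P q" "r \<notin> T \<Longrightarrow> P r = P q"
        using P[of p q] P[of q r] path in_verts False by auto
      have c: "connected_on H (verts H - T)"
        using clique_without_q[OF T False] assms by (simp add: clique_connected_def)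
      have P': "P u = P v" if "u \<in> verts H - T" "v \<in> verts H - T" "adj H u v" for u v
        using that P[of u v] pq by (auto simp: adj_H_iff verts_H doubleton_eq_iff)
      \<comment> \<open>A clique of \<open>G\<close> cannot contain both \<open>p\<close> and
        \<open>r\<close>, so one of them survives and carries the colour of
        \<open>q\<close>.\<close>
      obtain z where z: "z \<in> verts H - T" "P z = P q"
        using pq in_verts neqs clique_not_pr[OF T] by (auto simp: verts_H)
      have "P u = P q" if "u \<in> verts G - T" for u
      proof (cases "u = q")
        case False
        then have "u \<in> verts H - T" using that by (auto simp: verts_H)
        then show ?thesis using connected_onD[where P = P, OF c P' _ z(1)] z(2) by simp
      qed simp
      then show "P x = P y" using xy by simp
    qed
  qed
qed

end

lemma D3_step_cases:
  assumes "D3_step G H" "simple_graph G"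
  obtains p q r a b c w where "D3a_reduction G H p q r a b c w"
  | p q r s where "D3b_reduction G H p q r s"
  using assms(1)
proof cases
  case (D3a p q r a b c w)
  then show thesis using that(1)[of p q r a b c w] assms(2) by (simp add: D3a_reduction_def)
next
  case (D3b p q r s)
  then show thesis using that(2)[of p q r s] assms(2) by (simp add: D3b_reduction_def)
qed

section \<open>The base case and induction along the reductions\<close>

definition complete4 :: "'a ugraph \<Rightarrow> bool" where
  "complete4 G \<longleftrightarrow> card (verts G) = 4 \<and> clique G (verts G)"

lemma complete4_if_iso_K4:
  assumes "graph_iso G K4"
  shows "complete4 G"
proof -
  obtain f where f: "bij_betw f (verts G) (verts K4)"
    and adj: "\<And>u v. u \<in> verts G \<Longrightarrow> v \<in> verts G \<Longrightarrow> adj G u v \<longleftrightarrow> adj K4 (f u) (f v)"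
    using assms unfolding graph_iso_def by blast
  have "adj G u v" if "u \<in> verts G" "v \<in> verts G" "u \<noteq> v" for u v
  proof -
    have "f u \<noteq> f v" "f u \<in> verts K4" "f v \<in> verts K4"
      using that f by (auto simp: bij_betw_def inj_on_def)
    then show ?thesis using adj that by (auto simp: adj_def K4_def)
  qed
  then show ?thesis
    using bij_betw_same_card[OF f] by (auto simp: complete4_def clique_def K4_def)
qed

lemma clique_connected_complete4:
  assumes "complete4 G"
  shows "clique_connected G"
  unfolding clique_connected_def
proof (intro allI impI)
  fix T assume "clique G T"
  show "connected_on G (verts G - T)"
  proof (rule connected_onI)
    fix P :: "'a \<Rightarrow> bool" and x y
    assume P: "\<And>x y. x \<in> verts G - T \<Longrightarrow> y \<in> verts G - T \<Longrightarrow> adj G x y \<Longrightarrow> P x = P y"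
      and xy: "x \<in> verts G - T" "y \<in> verts G - T"
    have "x \<noteq> y \<Longrightarrow> adj G x y"
      using assms xy by (auto simp: complete4_def clique_def)
    then show "P x = P y" using P[OF xy] by (cases "x = y") auto
  qed
qed

lemma D3_step_simple: "D3_step G H \<Longrightarrow> simple_graph G \<Longrightarrow> simple_graph H"
  by (erule D3_step_cases) (auto intro: D3a_reduction.simple_H D3b_reduction.simple_H)

lemma D3_reducible_induct [consumes 2, case_names K4 step]:
  assumes "simple_graph G" "D3_reducible G"
    and "\<And>G :: 'a ugraph. simple_graph G \<Longrightarrow> complete4 G \<Longrightarrow> P G"
    and "\<And>G H :: 'a ugraph. simple_graph G \<Longrightarrow> D3_step G H \<Longrightarrow> P H \<Longrightarrow> P G"
  shows "P G"
proof -
  obtain K where K: "D3_step\<^sup>*\<^sup>* G K" "complete4 K"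
    using assms(2) complete4_if_iso_K4 unfolding D3_reducible_def by blast
  \<comment> \<open>The induction runs from the last graph back to the first, whereas simplicity is
    inherited in the forward direction; hence the implication.\<close>
  have "simple_graph G \<longrightarrow> P G"
    using K(1)
  proof (induction rule: converse_rtranclp_induct)
    case base
    then show ?case using assms(3) K(2) by blast
  next
    case (step G H)
    then show ?case using assms(4) D3_step_simple by blast
  qed
  then show ?thesis using assms(1) by blast
qed

lemma D3_reducible_clique_connected:
  assumes "simple_graph G" "D3_reducible G"
  shows "clique_connected G"
  using assms
proof (induction rule: D3_reducible_induct)
  case (K4 G)
  then show ?case by (simp add: clique_connected_complete4)
next
  case (step G H)
  from step(2,1) show ?case
    by (rule D3_step_cases)
      (auto intro: D3a_reduction.clique_connected_step D3b_reduction.clique_connected_step step(3))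
qed

section \<open>Linear realisations of complexes\<close>

text \<open>The points of the geometric realisation of \<open>K\<close>, in barycentric coordinates.\<close>

definition weights :: "'a set \<Rightarrow> 'a set set \<Rightarrow> ('a \<Rightarrow> real) set" where
  "weights V K = {\<alpha>. (\<forall>v. 0 \<le> \<alpha> v) \<and> sum \<alpha> V = 1 \<and> (\<exists>A\<in>K. A \<subseteq> V \<and> (\<forall>v. v \<notin> A \<longrightarrow> \<alpha> v = 0))}"

definition comb :: "'a set \<Rightarrow> ('a \<Rightarrow> complex) \<Rightarrow> ('a \<Rightarrow> real) \<Rightarrow> complex" where
  "comb V pos \<alpha> = (\<Sum>v\<in>V. \<alpha> v *\<^sub>R pos v)"

text \<open>Injectivity says at once that no simplex is degenerate and that two simplices meet
  exactly in their common face: a point in both has a single weight function, supported on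
  both.\<close>

definition realises :: "('a \<Rightarrow> complex) \<Rightarrow> 'a set \<Rightarrow> 'a set set \<Rightarrow> bool" where
  "realises pos V K \<longleftrightarrow> inj_on (comb V pos) (weights V K)"

lemma weightsI:
  "(\<And>v. 0 \<le> \<alpha> v) \<Longrightarrow> sum \<alpha> V = 1 \<Longrightarrow> A \<in> K \<Longrightarrow> A \<subseteq> V \<Longrightarrow> (\<And>v. v \<notin> A \<Longrightarrow> \<alpha> v = 0) \<Longrightarrow> \<alpha> \<in> weights V K"
  by (auto simp: weights_def)

lemma weightsE:
  assumes "\<alpha> \<in> weights V K"
  obtains A where "A \<in> K" "A \<subseteq> V" "\<And>v. v \<notin> A \<Longrightarrow> \<alpha> v = 0" "\<And>v. 0 \<le> \<alpha> v" "sum \<alpha> V = 1"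
proof -
  from assms obtain A where "A \<in> K" "A \<subseteq> V" "\<forall>v. v \<notin> A \<longrightarrow> \<alpha> v = 0"
    and "\<forall>v. 0 \<le> \<alpha> v" "sum \<alpha> V = 1"
    unfolding weights_def by blast
  then show thesis by (intro that[of A]) simp_all
qed

lemma weights_nonneg: "\<alpha> \<in> weights V K \<Longrightarrow> 0 \<le> \<alpha> v"
  by (simp add: weights_def)

lemma weights_sum: "\<alpha> \<in> weights V K \<Longrightarrow> sum \<alpha> V = 1"
  by (simp add: weights_def)

lemma realisesD:
  "realises pos V K \<Longrightarrow> \<alpha> \<in> weights V K \<Longrightarrow> \<beta> \<in> weights V K \<Longrightarrow> comb V pos \<alpha> = comb V pos \<beta> \<Longrightarrow> \<alpha> = \<beta>"
  by (auto simp: realises_def inj_on_def)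

text \<open>Weights may vanish on part of a simplex, so faces count automatically: \<open>K\<close>
  need not be closed under subsets and may be given by its large simplices.\<close>

lemma weights_mono:
  assumes "\<And>A. A \<in> L \<Longrightarrow> A \<subseteq> V \<Longrightarrow> \<exists>B\<in>K. B \<subseteq> V \<and> A \<subseteq> B"
  shows "weights V L \<subseteq> weights V K"
proof
  fix \<alpha> assume "\<alpha> \<in> weights V L"
  then obtain A where A: "A \<in> L" "A \<subseteq> V" "\<And>v. v \<notin> A \<Longrightarrow> \<alpha> v = 0" "\<And>v. 0 \<le> \<alpha> v" "sum \<alpha> V = 1"
    by (rule weightsE) (rule that)
  obtain B where "B \<in> K" "B \<subseteq> V" "A \<subseteq> B" using assms A(1,2) by blast
  then show "\<alpha> \<in> weights V K" using A(3-5) by (intro weightsI[of _ _ B]) auto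
qed

lemma realises_mono:
  assumes "realises pos V K" "\<And>A. A \<in> L \<Longrightarrow> A \<subseteq> V \<Longrightarrow> \<exists>B\<in>K. B \<subseteq> V \<and> A \<subseteq> B"
  shows "realises pos V L"
  using assms(1) weights_mono[of L V K] assms(2) unfolding realises_def by (meson inj_on_subset)

definition vert_weight :: "'a \<Rightarrow> 'a \<Rightarrow> real" where
  "vert_weight v = (\<lambda>u. if u = v then 1 else 0)"

lemma vert_weight_in:
  assumes "finite V" "A \<in> K" "A \<subseteq> V" "v \<in> A"
  shows "vert_weight v \<in> weights V K"
  using assms by (intro weightsI[of _ _ A]) (auto simp: vert_weight_def)

lemma comb_vert_weight:
  assumes "finite V" "v \<in> V"
  shows "comb V pos (vert_weight v) = pos v"
proof -
  have "comb V pos (vert_weight v) = (\<Sum>u\<in>V. if u = v then pos u else 0)"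
    unfolding comb_def vert_weight_def by (rule sum.cong) auto
  then show ?thesis using assms by simp
qed

text \<open>The simplicial map that sends each vertex \<open>x\<close> to the point with weights \<open>m x\<close>.\<close>

definition push :: "'a set \<Rightarrow> ('a \<Rightarrow> 'a \<Rightarrow> real) \<Rightarrow> ('a \<Rightarrow> real) \<Rightarrow> 'a \<Rightarrow> real" where
  "push V m \<alpha> u = (\<Sum>x\<in>V. \<alpha> x * m x u)"

lemma comb_push:
  assumes "\<And>x. x \<in> V \<Longrightarrow> comb U pos (m x) = pos' x"
  shows "comb U pos (push V m \<alpha>) = comb V pos' \<alpha>"
proof -
  have "comb U pos (push V m \<alpha>) = (\<Sum>u\<in>U. \<Sum>x\<in>V. \<alpha> x *\<^sub>R m x u *\<^sub>R pos u)"
    by (simp add: comb_def push_def scaleR_sum_left)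
  also have "\<dots> = (\<Sum>x\<in>V. \<Sum>u\<in>U. \<alpha> x *\<^sub>R m x u *\<^sub>R pos u)"
    by (rule sum.swap)
  also have "\<dots> = (\<Sum>x\<in>V. \<alpha> x *\<^sub>R comb U pos (m x))"
    by (simp add: comb_def scaleR_sum_right)
  finally show ?thesis using assms by (simp add: comb_def)
qed

lemma push_in_weights:
  assumes "\<alpha> \<in> weights V L" "\<And>x u. 0 \<le> m x u" "\<And>x. x \<in> V \<Longrightarrow> sum (m x) U = 1"
    and "B \<in> K" "B \<subseteq> U" "\<And>x u. \<alpha> x \<noteq> 0 \<Longrightarrow> u \<notin> B \<Longrightarrow> m x u = 0"
  shows "push V m \<alpha> \<in> weights U K"
proof (rule weightsI[of _ _ B])
  from assms(1) have \<alpha>: "\<And>v. 0 \<le> \<alpha> v" "sum \<alpha> V = 1"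
    by (simp_all add: weights_nonneg weights_sum)
  show "0 \<le> push V m \<alpha> v" for v
    unfolding push_def by (intro sum_nonneg mult_nonneg_nonneg \<alpha> assms)
  have "sum (push V m \<alpha>) U = (\<Sum>x\<in>V. \<Sum>u\<in>U. \<alpha> x * m x u)"
    unfolding push_def by (rule sum.swap)
  also have "\<dots> = (\<Sum>x\<in>V. \<alpha> x * sum (m x) U)"
    by (simp add: sum_distrib_left)
  finally show "sum (push V m \<alpha>) U = 1" using \<alpha> assms(3) by simp
  show "push V m \<alpha> v = 0" if "v \<notin> B" for v
    unfolding push_def using assms(6)[OF _ that] by (intro sum.neutral) auto
qed (use assms in auto)

text \<open>The new map \<open>comb V pos'\<close> is the old one after \<open>push\<close>. This
  reduces every geometric construction to two algebraic checks: \<open>push\<close> lands in the old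
  complex, and it is injective.\<close>

lemma realises_push:
  assumes "realises pos U K" "\<And>x. x \<in> V \<Longrightarrow> comb U pos (m x) = pos' x"
    and "push V m ` weights V L \<subseteq> weights U K"
    and "inj_on (push V m) (weights V L)"
  shows "realises pos' V L"
  unfolding realises_def
proof (rule inj_onI)
  fix \<alpha> \<beta> assume *: "\<alpha> \<in> weights V L" "\<beta> \<in> weights V L" "comb V pos' \<alpha> = comb V pos' \<beta>"
  then have "comb U pos (push V m \<alpha>) = comb U pos (push V m \<beta>)"
    using comb_push[of V U pos m pos', OF assms(2)] by simp
  then have "push V m \<alpha> = push V m \<beta>"
    using realisesD[OF assms(1)] assms(3) * by blast
  then show "\<alpha> = \<beta>" using assms(4) * by (auto dest: inj_onD)
qed

section \<open>Points on edges and the bisection of an edge\<close>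

definition edge_weight :: "'a \<Rightarrow> 'a \<Rightarrow> real \<Rightarrow> 'a \<Rightarrow> real" where
  "edge_weight u v t = (\<lambda>x. (1 - t) * vert_weight u x + t * vert_weight v x)"

lemma sum_vert_weight: "finite U \<Longrightarrow> u \<in> U \<Longrightarrow> sum (vert_weight u) U = 1"
  by (simp add: vert_weight_def)

lemma sum_edge_weight: "finite U \<Longrightarrow> u \<in> U \<Longrightarrow> v \<in> U \<Longrightarrow> sum (edge_weight u v t) U = 1"
  by (simp add: edge_weight_def sum.distrib sum_distrib_left[symmetric] sum_vert_weight)

lemma comb_edge_weight:
  assumes "finite U" "u \<in> U" "v \<in> U"
  shows "comb U pos (edge_weight u v t) = (1 - t) *\<^sub>R pos u + t *\<^sub>R pos v"
proof -
  have "comb U pos (edge_weight u v t)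
      = (1 - t) *\<^sub>R comb U pos (vert_weight u) + t *\<^sub>R comb U pos (vert_weight v)"
    by (simp add: comb_def edge_weight_def scaleR_add_left sum.distrib scaleR_sum_right)
  then show ?thesis using assms by (simp add: comb_vert_weight)
qed

lemma edge_weight_nonneg: "0 \<le> t \<Longrightarrow> t \<le> 1 \<Longrightarrow> 0 \<le> edge_weight u v t x"
  by (simp add: edge_weight_def vert_weight_def)

lemma sum_mult_vert_weight:
  assumes "finite V"
  shows "(\<Sum>x\<in>V. \<alpha> x * vert_weight x u) = (if u \<in> V then \<alpha> u else 0)"
proof -
  have "(\<Sum>x\<in>V. \<alpha> x * vert_weight x u) = (\<Sum>x\<in>V. if x = u then \<alpha> x else 0)"
    by (rule sum.cong) (auto simp: vert_weight_def)
  then show ?thesis using assms by simp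
qed

text \<open>No simplex of the subdivision contains both ends of the bisected edge, so the
  weight of the new vertex \<open>q\<close> is recovered as twice the smaller of the pushed weights at the ends.\<close>

lemma realises_bisect:
  assumes "finite V" "q \<notin> V" "p \<in> V" "r \<in> V" "p \<noteq> r" and K: "realises pos V K"
    and L: "\<And>A. A \<in> L \<Longrightarrow> p \<notin> A \<or> r \<notin> A"
      "\<And>A. A \<in> L \<Longrightarrow> q \<notin> A \<Longrightarrow> \<exists>B\<in>K. B \<subseteq> V \<and> A \<subseteq> B"
      "\<And>A. A \<in> L \<Longrightarrow> q \<in> A \<Longrightarrow> \<exists>B\<in>K. B \<subseteq> V \<and> insert p (insert r (A - {q})) \<subseteq> B"
  shows "realises (pos(q := midpoint (pos p) (pos r))) (insert q V) L"
proof -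
  define m where "m = vert_weight(q := edge_weight p r (1/2))"
  let ?V = "insert q V"
  have push: "push ?V m \<alpha> u = (if u \<in> V then \<alpha> u + (if u = p \<or> u = r then \<alpha> q / 2 else 0) else 0)" for \<alpha> u
  proof -
    have "push ?V m \<alpha> u = \<alpha> q * edge_weight p r (1/2) u + (\<Sum>x\<in>V. \<alpha> x * vert_weight x u)"
      unfolding push_def using assms(1,2) by (auto simp: m_def intro!: sum.cong)
    moreover have "edge_weight p r (1/2) u = (if u = p \<or> u = r then 1 / 2 else 0)"
      using assms(5) by (auto simp: edge_weight_def vert_weight_def)
    ultimately show ?thesis
      using assms(1,3,4) by (auto simp: sum_mult_vert_weight)
  qed
  show ?thesis
  proof (rule realises_push[OF K, where m = m])
    show "comb V pos (m x) = (pos(q := midpoint (pos p) (pos r))) x" if "x \<in> ?V" for x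
      using that assms by (auto simp: m_def comb_vert_weight comb_edge_weight midpoint_def scaleR_add_right)
    show "push ?V m ` weights ?V L \<subseteq> weights V K"
    proof clarify
      fix \<alpha> assume \<alpha>: "\<alpha> \<in> weights ?V L"
      then obtain A where A: "A \<in> L" "A \<subseteq> ?V" "\<And>v. v \<notin> A \<Longrightarrow> \<alpha> v = 0"
        by (rule weightsE) (rule that)
      \<comment> \<open>Since \<open>q\<close> is pushed to the middle of \<open>{p, r}\<close>, a
        simplex with \<open>q\<close> must land in a simplex of \<open>K\<close> that contains both
        ends.\<close>
      obtain B where B: "B \<in> K" "B \<subseteq> V" "A - {q} \<subseteq> B" "q \<in> A \<Longrightarrow> p \<in> B \<and> r \<in> B"
        using L(2,3)[OF A(1)] by (cases "q \<in> A") auto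
      have "m x u = 0" if "\<alpha> x \<noteq> 0" "u \<notin> B" for x u
        using A(3)[of x] B that by (cases "x = q") (auto simp: m_def edge_weight_def vert_weight_def)
      then show "push ?V m \<alpha> \<in> weights V K"
        using assms B
        by (intro push_in_weights[OF \<alpha> _ _ B(1)])
          (auto simp: m_def sum_vert_weight sum_edge_weight edge_weight_nonneg, simp add: vert_weight_def)
    qed
    show "inj_on (push ?V m) (weights ?V L)"
    proof (rule inj_onI)
      fix \<alpha> \<beta> assume \<alpha>: "\<alpha> \<in> weights ?V L" and \<beta>: "\<beta> \<in> weights ?V L"
        and eq: "push ?V m \<alpha> = push ?V m \<beta>"
      have z: "\<gamma> p = 0 \<or> \<gamma> r = 0" "\<And>v. 0 \<le> \<gamma> v" "\<And>v. v \<notin> ?V \<Longrightarrow> \<gamma> v = 0"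
        if "\<gamma> \<in> weights ?V L" for \<gamma>
      proof -
        from that obtain A where "A \<in> L" "A \<subseteq> ?V" "\<And>v. v \<notin> A \<Longrightarrow> \<gamma> v = 0" "\<And>v. 0 \<le> \<gamma> v"
          by (rule weightsE) (rule that)
        then show "\<gamma> p = 0 \<or> \<gamma> r = 0" "\<And>v. 0 \<le> \<gamma> v" "\<And>v. v \<notin> ?V \<Longrightarrow> \<gamma> v = 0"
          using L(1) by blast+
      qed
      have p: "\<alpha> p + \<alpha> q / 2 = \<beta> p + \<beta> q / 2" and r: "\<alpha> r + \<alpha> q / 2 = \<beta> r + \<beta> q / 2"
        using fun_cong[OF eq, of p] fun_cong[OF eq, of r] assms by (simp_all add: push)
      then have q: "\<alpha> q = \<beta> q"
        using z(1,2)[OF \<alpha>] z(1,2)[OF \<beta>] by (smt (verit) field_sum_of_halves)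
      show "\<alpha> = \<beta>"
      proof
        fix u
        show "\<alpha> u = \<beta> u"
          using p q r fun_cong[OF eq, of u] z(3)[OF \<alpha>, of u] z(3)[OF \<beta>, of u]
          by (cases "u \<in> V"; cases "u = q") (auto simp: push split: if_splits)
      qed
    qed
  qed
qed

section \<open>Replacing a vertex by points on its edges\<close>

text \<open>The simplices at \<open>w\<close> are discarded, except that of each edge
  \<open>{w, n x}\<close> the piece from \<open>x\<close> to \<open>n x\<close> is kept. The pushed
  weight at \<open>w\<close> detects \<open>x\<close>: it is zero on old simplices and positive as
  soon as \<open>x\<close> has positive weight. The set \<open>R\<close> may contain
  \<open>w\<close> itself, as in \<open>D3a\<close>.\<close>

lemma realises_split_vertex:
  fixes t :: "'a \<Rightarrow> real"
  assumes "finite V" "w \<in> V" and K: "realises pos V K"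
    and R: "finite R" "R \<inter> (V - {w}) = {}" "inj_on n R" "n ` R \<subseteq> V - {w}"
    and t: "\<And>x. x \<in> R \<Longrightarrow> 0 < t x \<and> t x < 1"
    and edge: "\<And>x. x \<in> R \<Longrightarrow> {w, n x} \<in> K"
  shows "realises (\<lambda>v. if v \<in> R then (1 - t v) *\<^sub>R pos w + t v *\<^sub>R pos (n v) else pos v)
     (V - {w} \<union> R) ({A \<in> K. A \<subseteq> V - {w}} \<union> (\<lambda>x. {x, n x}) ` R)"
    (is "realises ?pos ?V ?L")
proof -
  define m where "m = (\<lambda>x. if x \<in> R then edge_weight w (n x) (t x) else vert_weight x)"
  let ?W = "V - {w}"
  have fin: "finite ?V" using assms by simp
  have nW: "n x \<in> ?W" and nR: "n x \<notin> R" and nx: "n x \<noteq> x" "n x \<noteq> w" if "x \<in> R" for x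
  proof -
    show "n x \<in> ?W" using R(4) that by blast
    then show "n x \<notin> R" "n x \<noteq> w" using R(2) by blast+
    then show "n x \<noteq> x" using that by metis
  qed
  have cases: "(\<exists>A\<in>K. A \<subseteq> ?W \<and> (\<forall>v. v \<notin> A \<longrightarrow> \<alpha> v = 0)) \<or>
      (\<exists>x\<in>R. \<forall>v. v \<notin> {x, n x} \<longrightarrow> \<alpha> v = 0)" if "\<alpha> \<in> weights ?V ?L" for \<alpha>
  proof -
    from that obtain A where "A \<in> ?L" "\<forall>v. v \<notin> A \<longrightarrow> \<alpha> v = 0"
      unfolding weights_def by blast
    then show ?thesis by blast
  qed
  have nonneg: "0 \<le> \<alpha> v" if "\<alpha> \<in> weights ?V ?L" for \<alpha> v
    using that by (rule weights_nonneg)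
  have old: "push ?V m \<alpha> = \<alpha>" if "\<And>v. v \<notin> ?W \<Longrightarrow> \<alpha> v = 0" for \<alpha>
  proof
    fix u
    have "push ?V m \<alpha> u = (\<Sum>x\<in>?V. \<alpha> x * vert_weight x u)"
      unfolding push_def using R(2) that by (intro sum.cong) (auto simp: m_def)
    then show "push ?V m \<alpha> u = \<alpha> u"
      using fin that[of u] by (simp add: sum_mult_vert_weight)
  qed
  have new: "push ?V m \<alpha> u = \<alpha> x * edge_weight w (n x) (t x) u + \<alpha> (n x) * vert_weight (n x) u"
    if x: "x \<in> R" and \<alpha>: "\<And>v. v \<notin> {x, n x} \<Longrightarrow> \<alpha> v = 0" for \<alpha> x u
  proof -
    note nx = nW[OF x] nR[OF x] nx(1)[OF x]
    have "push ?V m \<alpha> u = (\<Sum>y\<in>{x, n x}. \<alpha> y * m y u)"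
      unfolding push_def using fin x nx by (intro sum.mono_neutral_right) (auto simp: \<alpha>)
    then show ?thesis using x nx by (simp add: m_def)
  qed
  show ?thesis
  proof (rule realises_push[OF K, where m = m])
    show "comb V pos (m x) = ?pos x" if "x \<in> ?V" for x
      using that assms by (auto simp: m_def comb_vert_weight comb_edge_weight image_subset_iff)
    show "push ?V m ` weights ?V ?L \<subseteq> weights V K"
    proof clarify
      fix \<alpha> assume \<alpha>: "\<alpha> \<in> weights ?V ?L"
      have "\<exists>B\<in>K. B \<subseteq> V \<and> (\<forall>x u. \<alpha> x \<noteq> 0 \<longrightarrow> u \<notin> B \<longrightarrow> m x u = 0)"
        using cases[OF \<alpha>]
      proof (elim disjE bexE conjE)
        fix A assume A: "A \<in> K" "A \<subseteq> ?W" "\<forall>v. v \<notin> A \<longrightarrow> \<alpha> v = 0"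
        have "m x u = 0" if "\<alpha> x \<noteq> 0" "u \<notin> A" for x u
        proof -
          have "x \<in> A" using A(3) that by blast
          then have "x \<notin> R" "u \<noteq> x" using A(2) R(2) that by auto
          then show ?thesis by (simp add: m_def vert_weight_def)
        qed
        then show ?thesis using A by blast
      next
        fix x assume x: "x \<in> R" "\<forall>v. v \<notin> {x, n x} \<longrightarrow> \<alpha> v = 0"
        note nx = nW[OF x(1)] nR[OF x(1)]
        have "m y u = 0" if "\<alpha> y \<noteq> 0" "u \<notin> {w, n x}" for y u
        proof -
          have "y = x \<or> y = n x" using x(2) that by blast
          then show ?thesis using that x nx by (auto simp: m_def edge_weight_def vert_weight_def)
        qed
        then show ?thesis using edge[OF x(1)] nx \<open>w \<in> V\<close> by (intro bexI[of _ "{w, n x}"]) auto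
      qed
      then obtain B where B: "B \<in> K" "B \<subseteq> V" "\<And>x u. \<alpha> x \<noteq> 0 \<Longrightarrow> u \<notin> B \<Longrightarrow> m x u = 0"
        by blast
      have "0 \<le> m x u" for x u
        using t by (auto simp: m_def less_imp_le edge_weight_nonneg) (simp add: vert_weight_def)
      moreover have "sum (m x) V = 1" if "x \<in> ?V" for x
        using that assms by (auto simp: m_def sum_vert_weight sum_edge_weight image_subset_iff)
      ultimately show "push ?V m \<alpha> \<in> weights V K"
        using B by (intro push_in_weights[OF \<alpha> _ _ B(1)]) auto
    qed
    \<comment> \<open>On a kept piece, \<open>\<alpha> x = 0\<close> means the old vertex
      \<open>n x\<close>; counting it as old makes the two cases exclusive.\<close>
    have split: "(\<forall>v. v \<notin> ?W \<longrightarrow> \<alpha> v = 0) \<or>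
        (\<exists>x\<in>R. 0 < \<alpha> x \<and> (\<forall>v. v \<notin> {x, n x} \<longrightarrow> \<alpha> v = 0))" if "\<alpha> \<in> weights ?V ?L" for \<alpha>
      using cases[OF that]
    proof (elim disjE bexE conjE)
      fix x assume x: "x \<in> R" "\<forall>v. v \<notin> {x, n x} \<longrightarrow> \<alpha> v = 0"
      show ?thesis
      proof (cases "\<alpha> x = 0")
        case True
        then have "\<alpha> v = 0" if "v \<notin> ?W" for v
          using x R(4) that by (cases "v = x") (auto simp: image_subset_iff)
        then show ?thesis by blast
      next
        case False
        then show ?thesis using x nonneg[OF that, of x] by (auto simp: less_le)
      qed
    qed blast
    have new_w: "push ?V m \<alpha> w = \<alpha> x * (1 - t x)"
      and new_n: "push ?V m \<alpha> (n x) = \<alpha> x * t x + \<alpha> (n x)"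
      and new_0: "\<And>u. u \<notin> {w, n x} \<Longrightarrow> push ?V m \<alpha> u = 0"
      if "x \<in> R" "\<forall>v. v \<notin> {x, n x} \<longrightarrow> \<alpha> v = 0" for \<alpha> x
    proof -
      note nx = nx(2)[OF that(1)]
      then show "push ?V m \<alpha> w = \<alpha> x * (1 - t x)" "push ?V m \<alpha> (n x) = \<alpha> x * t x + \<alpha> (n x)"
        "\<And>u. u \<notin> {w, n x} \<Longrightarrow> push ?V m \<alpha> u = 0"
        using new[OF that(1), of \<alpha>] that(2) by (auto simp: edge_weight_def vert_weight_def)
    qed
    show "inj_on (push ?V m) (weights ?V ?L)"
    proof (rule inj_onI)
      fix \<alpha> \<beta> assume \<alpha>: "\<alpha> \<in> weights ?V ?L" and \<beta>: "\<beta> \<in> weights ?V ?L"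
        and eq: "push ?V m \<alpha> = push ?V m \<beta>"
      have pos_w: "0 < push ?V m \<gamma> w"
        if "x \<in> R" "0 < \<gamma> x" "\<forall>v. v \<notin> {x, n x} \<longrightarrow> \<gamma> v = 0" for \<gamma> x
        using new_w[OF that(1,3)] t[OF that(1)] that(2) by simp
      have zero_w: "push ?V m \<gamma> w = 0" if "\<forall>v. v \<notin> ?W \<longrightarrow> \<gamma> v = 0" for \<gamma>
        using old[of \<gamma>] that by simp
      show "\<alpha> = \<beta>"
        using split[OF \<alpha>] split[OF \<beta>]
      proof (elim disjE bexE conjE)
        assume "\<forall>v. v \<notin> ?W \<longrightarrow> \<alpha> v = 0" "\<forall>v. v \<notin> ?W \<longrightarrow> \<beta> v = 0"
        then show ?thesis using old[of \<alpha>] old[of \<beta>] eq by simp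
      next
        fix x assume "\<forall>v. v \<notin> ?W \<longrightarrow> \<alpha> v = 0"
          "x \<in> R" "0 < \<beta> x" "\<forall>v. v \<notin> {x, n x} \<longrightarrow> \<beta> v = 0"
        then show ?thesis using zero_w[of \<alpha>] pos_w[of x \<beta>] eq by simp
      next
        fix x assume "\<forall>v. v \<notin> ?W \<longrightarrow> \<beta> v = 0"
          "x \<in> R" "0 < \<alpha> x" "\<forall>v. v \<notin> {x, n x} \<longrightarrow> \<alpha> v = 0"
        then show ?thesis using zero_w[of \<beta>] pos_w[of x \<alpha>] eq by simp
      next
        fix x y
        assume x: "x \<in> R" "0 < \<alpha> x" "\<forall>v. v \<notin> {x, n x} \<longrightarrow> \<alpha> v = 0"
          and y: "y \<in> R" "0 < \<beta> y" "\<forall>v. v \<notin> {y, n y} \<longrightarrow> \<beta> v = 0"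
        \<comment> \<open>Since \<open>t x\<close> is positive, \<open>n x\<close> shows in the
          pushed weights; by injectivity of \<open>n\<close> it determines \<open>x\<close>. Since
          \<open>t x\<close> is below 1, the weight at \<open>w\<close> then determines
          \<open>\<alpha> x\<close>.\<close>
        have "0 < push ?V m \<alpha> (n x)"
          using new_n[OF x(1,3)] t[OF x(1)] x(2) nonneg[OF \<alpha>, of "n x"] by (simp add: add_pos_nonneg)
        then have "n x \<in> {w, n y}"
          using new_0[OF y(1,3), of "n x"] eq by auto
        then have "n x = n y" using nx(2)[OF x(1)] by blast
        then have xy: "x = y" using R(3) x(1) y(1) by (auto dest: inj_onD)
        have "\<alpha> x * (1 - t x) = \<beta> x * (1 - t x)"
          using new_w[OF x(1,3)] new_w[OF y(1,3)] unfolding eq xy by metis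
        then have 1: "\<alpha> x = \<beta> x" using t[OF x(1)] by simp
        then have 2: "\<alpha> (n x) = \<beta> (n x)"
          using new_n[OF x(1,3)] new_n[OF y(1,3)] eq xy by simp
        show ?thesis
        proof
          fix v show "\<alpha> v = \<beta> v" using 1 2 x(3) y(3) xy by (cases "v \<in> {x, n x}") auto
        qed
      qed
    qed
  qed
qed

section \<open>Truncating a vertex by a small circle\<close>

lemma comb_support:
  fixes \<alpha> :: "'a \<Rightarrow> real"
  assumes "finite V" "A \<subseteq> V" "\<And>v. v \<notin> A \<Longrightarrow> \<alpha> v = 0"
  shows "comb V pos \<alpha> = comb A pos \<alpha>"
  unfolding comb_def using assms by (intro sum.mono_neutral_right) auto

lemma comb_in_convex:
  fixes \<alpha> :: "'a \<Rightarrow> real"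
  assumes "convex S" "finite V" "A \<subseteq> V" "\<And>v. v \<notin> A \<Longrightarrow> \<alpha> v = 0" "\<And>v. 0 \<le> \<alpha> v" "sum \<alpha> V = 1"
    and "pos ` A \<subseteq> S"
  shows "comb V pos \<alpha> \<in> S"
proof -
  have "sum \<alpha> V = sum \<alpha> A"
    using assms(2-4) by (intro sum.mono_neutral_right) auto
  then have "comb A pos \<alpha> \<in> S"
    unfolding comb_def using assms by (intro convex_sum finite_subset[OF assms(3,2)]) auto
  then show ?thesis using comb_support[OF assms(2-4), where pos = pos] by simp
qed

lemma convex_hull_subset_comb:
  assumes "finite V" "A \<subseteq> V"
  shows "convex hull (pos ` A) \<subseteq> comb V pos ` weights V {A}"
proof (rule hull_minimal)
  show "pos ` A \<subseteq> comb V pos ` weights V {A}"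
  proof
    fix y assume "y \<in> pos ` A"
    then obtain v where "v \<in> A" "y = pos v" by blast
    then show "y \<in> comb V pos ` weights V {A}"
      using assms vert_weight_in[of V A "{A}" v] comb_vert_weight[of V v pos]
      by (intro image_eqI[of _ _ "vert_weight v"]) auto
  qed
  show "convex (comb V pos ` weights V {A})"
    unfolding convex_def
  proof clarify
    fix u v :: real and \<alpha> \<beta>
    assume uv: "0 \<le> u" "0 \<le> v" "u + v = 1" and \<alpha>: "\<alpha> \<in> weights V {A}" and \<beta>: "\<beta> \<in> weights V {A}"
    let ?\<gamma> = "\<lambda>x. u * \<alpha> x + v * \<beta> x"
    have "sum ?\<gamma> V = u * sum \<alpha> V + v * sum \<beta> V"
      by (simp add: sum.distrib sum_distrib_left)
    then have \<gamma>: "?\<gamma> \<in> weights V {A}"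
      using uv \<alpha> \<beta> assms by (auto simp: weights_def)
    have "comb V pos ?\<gamma> = u *\<^sub>R comb V pos \<alpha> + v *\<^sub>R comb V pos \<beta>"
      by (simp add: comb_def scaleR_add_left sum.distrib scaleR_sum_right)
    then show "u *\<^sub>R comb V pos \<alpha> + v *\<^sub>R comb V pos \<beta> \<in> comb V pos ` weights V {A}"
      using \<gamma> by (rule image_eqI[OF sym])
  qed
qed

text \<open>The hulls of the simplices with \<open>w\<close> removed form a compact set. By
  injectivity it misses \<open>pos w\<close>, hence keeps a positive distance, from which the radius
  of the circle is taken.\<close>

lemma realises_far:
  assumes "finite V" and K: "realises pos V K" and w: "w \<in> C" "C \<in> K" "C \<subseteq> V"
  obtains e where "0 < e" "\<And>\<alpha>. \<alpha> \<in> weights V K \<Longrightarrow> \<alpha> w = 0 \<Longrightarrow> e < dist (pos w) (comb V pos \<alpha>)"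
proof -
  define S where "S = (\<Union>A\<in>K \<inter> Pow V. convex hull (pos ` (A - {w})))"
  have "compact S"
    unfolding S_def using assms(1)
    by (intro compact_UN finite_imp_compact_convex_hull) (auto intro: finite_subset)
  have "pos w \<notin> S"
  proof
    assume "pos w \<in> S"
    then obtain A where A: "A \<in> K" "A \<subseteq> V" "pos w \<in> convex hull (pos ` (A - {w}))"
      by (auto simp: S_def)
    then have "pos w \<in> comb V pos ` weights V {A - {w}}"
      using convex_hull_subset_comb[of V "A - {w}" pos] assms(1) by blast
    then obtain \<alpha> where \<alpha>: "\<alpha> \<in> weights V {A - {w}}" "comb V pos \<alpha> = pos w"
      by auto
    have "\<alpha> \<in> weights V K"
      using \<alpha>(1) A weights_mono[of "{A - {w}}" V K] by blast
    moreover have "vert_weight w \<in> weights V K"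
      using vert_weight_in[OF assms(1) w(2,3,1)] .
    moreover have "comb V pos (vert_weight w) = pos w"
      by (rule comb_vert_weight[OF assms(1)]) (use w in blast)
    ultimately have "\<alpha> = vert_weight w" using realisesD[OF K] \<alpha>(2) by metis
    then have "\<alpha> w = 1" by (simp add: vert_weight_def)
    then show False using \<alpha>(1) by (auto simp: weights_def)
  qed
  then obtain d where d: "d > 0" "ball (pos w) d \<subseteq> - S"
    using \<open>compact S\<close> by (meson ComplI compact_imp_closed open_Compl open_contains_ball)
  \<comment> \<open>Half the radius turns the weak bound into a strict one.\<close>
  have "d / 2 < dist (pos w) (comb V pos \<alpha>)" if "\<alpha> \<in> weights V K" "\<alpha> w = 0" for \<alpha>
  proof -
    from that(1) obtain A where A: "A \<in> K" "A \<subseteq> V" "\<And>v. v \<notin> A \<Longrightarrow> \<alpha> v = 0" "\<And>v. 0 \<le> \<alpha> v" "sum \<alpha> V = 1"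
      by (rule weightsE) (rule that)
    have "\<alpha> v = 0" if "v \<notin> A - {w}" for v
      using A(3)[of v] \<open>\<alpha> w = 0\<close> that by (cases "v = w") auto
    then have "comb V pos \<alpha> \<in> convex hull (pos ` (A - {w}))"
      using A assms(1) by (intro comb_in_convex[of _ V "A - {w}"]) (auto simp: hull_subset)
    then have "comb V pos \<alpha> \<in> S" using A by (auto simp: S_def)
    then have "comb V pos \<alpha> \<notin> ball (pos w) d" using d(2) by blast
    then show ?thesis using d(1) by simp
  qed
  then show thesis using that[of "d / 2"] d(1) by simp
qed

text \<open>A line meets a circle at most twice: were the points collinear, then
  \<open>y = k *\<^sub>R x\<close>, and subtracting the circle equations leaves
  \<open>k * (k - 1) = 0\<close>, so two points would coincide.\<close>

lemma cocircular_affine_independent: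
  fixes P Q R z :: complex
  assumes "P \<noteq> Q" "P \<noteq> R" "Q \<noteq> R" "dist z P = e" "dist z Q = e" "dist z R = e"
    and "a + b + c = 0" "a *\<^sub>R P + b *\<^sub>R Q + c *\<^sub>R R = 0"
  shows "a = 0" "b = 0" "c = 0"
proof -
  define x y where "x = Q - P" and "y = R - P"
  define o' where "o' = P - z"
  have n: "norm o' = e" "norm (o' + x) = e" "norm (o' + y) = e"
    using assms(4-6) by (simp_all add: x_def y_def o'_def dist_norm norm_minus_commute)
  have "b *\<^sub>R x + c *\<^sub>R y = a *\<^sub>R P + b *\<^sub>R Q + c *\<^sub>R R - (a + b + c) *\<^sub>R P"
    by (simp add: x_def y_def algebra_simps)
  then have bc: "b *\<^sub>R x + c *\<^sub>R y = 0" using assms by simp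
  have xy: "x \<noteq> 0" "y \<noteq> 0" "x \<noteq> y" using assms by (auto simp: x_def y_def)
  have c: "c = 0"
  proof (rule ccontr)
    assume "c \<noteq> 0"
    define k where "k = - b / c"
    have "c *\<^sub>R y = c *\<^sub>R (k *\<^sub>R x)"
      using bc \<open>c \<noteq> 0\<close> by (simp add: k_def eq_neg_iff_add_eq_0 add.commute)
    then have y: "y = k *\<^sub>R x" using \<open>c \<noteq> 0\<close> scaleR_left_imp_eq by blast
    have "o' \<bullet> o' = e\<^sup>2" "(o' + x) \<bullet> (o' + x) = e\<^sup>2" "(o' + y) \<bullet> (o' + y) = e\<^sup>2"
      using n by (simp_all add: power2_norm_eq_inner[symmetric])
    then have nx: "2 * (o' \<bullet> x) + x \<bullet> x = 0" and "2 * k * (o' \<bullet> x) + k * k * (x \<bullet> x) = 0"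
      by (simp_all add: y inner_add inner_commute)
    moreover have "o' \<bullet> x = - (x \<bullet> x) / 2" using nx by simp
    ultimately have "k * (k - 1) * (x \<bullet> x) = 0" by (simp add: algebra_simps)
    then have "k = 0 \<or> k = 1" using xy by simp
    then show False using y xy by auto
  qed
  with bc xy show "b = 0" "c = 0" by auto
  then show "a = 0" using assms by simp
qed

text \<open>The inscribed triangle lies in the closed disc, which by \<open>touch\<close> the old
  complex meets only in the corners. So a coincidence of old and new points happens at a corner, and
  within the triangle the corners are affinely independent.\<close>

lemma realises_insert_triangle:
  assumes "finite V" "distinct [p, q, r]" "{p, q, r} \<subseteq> V" and L: "realises pos V L"
    and vert: "\<And>x. x \<in> {p, q, r} \<Longrightarrow> vert_weight x \<in> weights V L"
    and circle: "\<And>x. x \<in> {p, q, r} \<Longrightarrow> dist z (pos x) = e"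
    and touch: "\<And>\<alpha>. \<alpha> \<in> weights V L \<Longrightarrow> dist z (comb V pos \<alpha>) \<le> e \<Longrightarrow> \<exists>x\<in>{p, q, r}. \<alpha> = vert_weight x"
  shows "realises pos V (insert {p, q, r} L)"
proof -
  let ?T = "weights V {{p, q, r}}"
  have dec: "\<alpha> \<in> weights V L \<or> \<alpha> \<in> ?T" if "\<alpha> \<in> weights V (insert {p, q, r} L)" for \<alpha>
    using that unfolding weights_def by auto
  have TD: "\<And>v. v \<notin> {p, q, r} \<Longrightarrow> \<alpha> v = 0" "\<And>v. 0 \<le> \<alpha> v" "sum \<alpha> V = 1"
    if "\<alpha> \<in> ?T" for \<alpha>
    using that unfolding weights_def by auto
  have posne: "pos x \<noteq> pos y" if "x \<in> {p, q, r}" "y \<in> {p, q, r}" "x \<noteq> y" for x y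
  proof
    assume "pos x = pos y"
    then have "comb V pos (vert_weight x) = comb V pos (vert_weight y)"
      using that assms(1,3) comb_vert_weight[of V _ pos] by (metis subsetD)
    then have "vert_weight x = vert_weight y"
      using realisesD[OF L] vert that by blast
    then have "vert_weight x x = vert_weight y x" by simp
    then show False using that by (simp add: vert_weight_def)
  qed
  have TT: "\<alpha> = \<beta>" if \<alpha>: "\<alpha> \<in> ?T" and \<beta>: "\<beta> \<in> ?T" and eq: "comb V pos \<alpha> = comb V pos \<beta>" for \<alpha> \<beta>
  proof -
    have c: "comb V pos \<gamma> = \<gamma> p *\<^sub>R pos p + \<gamma> q *\<^sub>R pos q + \<gamma> r *\<^sub>R pos r"
      "\<gamma> p + \<gamma> q + \<gamma> r = 1" if "\<gamma> \<in> ?T" for \<gamma>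
    proof -
      show "comb V pos \<gamma> = \<gamma> p *\<^sub>R pos p + \<gamma> q *\<^sub>R pos q + \<gamma> r *\<^sub>R pos r"
        using comb_support[OF assms(1,3) TD(1)[OF that], where pos = pos] assms(2)
        by (simp add: comb_def add.assoc)
      have "sum \<gamma> V = sum \<gamma> {p, q, r}"
        using assms(1,3) TD(1)[OF that] by (intro sum.mono_neutral_right) auto
      then show "\<gamma> p + \<gamma> q + \<gamma> r = 1"
        using TD(3)[OF that] assms(2) by (simp add: add.assoc)
    qed
    have "(\<alpha> p - \<beta> p) *\<^sub>R pos p + (\<alpha> q - \<beta> q) *\<^sub>R pos q + (\<alpha> r - \<beta> r) *\<^sub>R pos r = 0"
      using c(1)[OF \<alpha>] c(1)[OF \<beta>] eq by (simp add: algebra_simps)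
    moreover have "(\<alpha> p - \<beta> p) + (\<alpha> q - \<beta> q) + (\<alpha> r - \<beta> r) = 0"
      using c(2)[OF \<alpha>] c(2)[OF \<beta>] by simp
    moreover have "pos p \<noteq> pos q" "pos p \<noteq> pos r" "pos q \<noteq> pos r"
      using posne[of p q] posne[of p r] posne[of q r] assms(2) by simp_all
    moreover have "dist z (pos p) = e" "dist z (pos q) = e" "dist z (pos r) = e"
      by (simp_all add: circle)
    ultimately have 0: "\<alpha> p - \<beta> p = 0" "\<alpha> q - \<beta> q = 0" "\<alpha> r - \<beta> r = 0"
      by (meson cocircular_affine_independent)+
    show ?thesis
    proof
      fix v show "\<alpha> v = \<beta> v"
        using 0 TD(1)[OF \<alpha>, of v] TD(1)[OF \<beta>, of v] by (cases "v \<in> {p, q, r}") auto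
    qed
  qed
  have LT: "\<alpha> = \<beta>" if \<alpha>: "\<alpha> \<in> weights V L" and \<beta>: "\<beta> \<in> ?T" and eq: "comb V pos \<alpha> = comb V pos \<beta>" for \<alpha> \<beta>
  proof -
    have "comb V pos \<beta> \<in> cball z e"
      using assms(1,3) TD[OF \<beta>] circle by (intro comb_in_convex[of _ V "{p, q, r}"]) auto
    then obtain x where x: "x \<in> {p, q, r}" "\<alpha> = vert_weight x"
      using touch[OF \<alpha>] eq by auto
    then have "\<alpha> \<in> ?T" using vert_weight_in[of V "{p, q, r}" "{{p, q, r}}" x] assms by simp
    then show ?thesis using TT[OF _ \<beta> eq] by blast
  qed
  show ?thesis
    unfolding realises_def
  proof (rule inj_onI)
    fix \<alpha> \<beta> assume "\<alpha> \<in> weights V (insert {p, q, r} L)" "\<beta> \<in> weights V (insert {p, q, r} L)"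
      and eq: "comb V pos \<alpha> = comb V pos \<beta>"
    then show "\<alpha> = \<beta>"
      using dec[of \<alpha>] dec[of \<beta>] TT[of \<alpha> \<beta>] LT[of \<alpha> \<beta>] LT[of \<beta> \<alpha>] realisesD[OF L, of \<alpha> \<beta>] by metis
  qed
qed

text \<open>Cutting off the vertex \<open>w\<close> by a small circle: \<open>p\<close>, \<open>q\<close>, \<open>r\<close> are the points where the circle
  meets the edges at \<open>w\<close>, and the new triangle is inscribed in it.\<close>

lemma realises_truncate:
  assumes "finite V" "w \<in> V" and K: "realises pos V K"
    and pqr: "distinct [p, q, r]" "{p, q, r} \<inter> (V - {w}) = {}"
    and abc: "distinct [a, b, c]" "{a, b, c} \<subseteq> V - {w}"
    and edge: "{w, a} \<in> K" "{w, b} \<in> K" "{w, c} \<in> K"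
  obtains pos' where "realises pos' (V - {w} \<union> {p, q, r})
     (insert {p, q, r} ({A \<in> K. A \<subseteq> V - {w}} \<union> {{p, a}, {q, b}, {r, c}}))"
proof -
  define n where "n = (\<lambda>x. if x = p then a else if x = q then b else c)"
  let ?R = "{p, q, r}"
  let ?V = "V - {w} \<union> ?R"
  have n_simps: "n p = a" "n q = b" "n r = c"
    using pqr(1) by (auto simp: n_def)
  have nW: "n x \<in> V" "n x \<noteq> w" "n x \<notin> ?R" and nK: "{w, n x} \<in> K" if "x \<in> ?R" for x
    using that abc(2) pqr(2) edge n_simps by auto
  have inj: "inj_on n ?R"
    using n_simps abc(1) by (auto simp: inj_on_def)
  obtain e where e: "0 < e" "\<And>\<alpha>. \<alpha> \<in> weights V K \<Longrightarrow> \<alpha> w = 0 \<Longrightarrow> e < dist (pos w) (comb V pos \<alpha>)"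
    using realises_far[OF assms(1) K, of w "{w, a}"] assms(2) edge(1) abc(2) by auto
  define d where "d = (\<lambda>x. norm (pos (n x) - pos w))"
  have d: "e < d x" if "x \<in> ?R" for x
  proof -
    have "vert_weight (n x) \<in> weights V K"
      using vert_weight_in[OF assms(1) nK[OF that], of "n x"] nW[OF that] assms(2) by simp
    moreover have "vert_weight (n x) w = 0"
      using nW[OF that] by (simp add: vert_weight_def)
    ultimately show ?thesis
      using e(2) comb_vert_weight[OF assms(1) nW(1)[OF that], of pos]
      by (metis d_def dist_commute dist_norm)
  qed
  \<comment> \<open>This puts the new vertex at distance \<open>e\<close> from \<open>pos w\<close>.
    As \<open>n x\<close> lies farther away than \<open>e\<close>, the point is strictly inside the
    edge.\<close>
  define t where "t = (\<lambda>x. e / d x)"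
  have t: "0 < t x \<and> t x < 1" "t x * d x = e" if "x \<in> ?R" for x
    using d[OF that] e(1) by (auto simp: t_def)
  define pos' where "pos' = (\<lambda>v. if v \<in> ?R then (1 - t v) *\<^sub>R pos w + t v *\<^sub>R pos (n v) else pos v)"
  define L where "L = {A \<in> K. A \<subseteq> V - {w}} \<union> (\<lambda>x. {x, n x}) ` ?R"
  have L: "realises pos' ?V L"
    unfolding pos'_def L_def
    by (rule realises_split_vertex[OF assms(1,2) K _ pqr(2) inj]) (use nW nK t in auto)
  have "realises pos' ?V (insert ?R L)"
  proof (rule realises_insert_triangle[OF _ pqr(1) _ L, where z = "pos w" and e = e])
    show "vert_weight x \<in> weights ?V L" if "x \<in> ?R" for x
      by (rule vert_weight_in[of _ "{x, n x}"]) (use assms(1) that nW[OF that] in \<open>auto simp: L_def\<close>)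
    show "dist (pos w) (pos' x) = e" if "x \<in> ?R" for x
    proof -
      have "pos' x - pos w = t x *\<^sub>R (pos (n x) - pos w)"
        using that by (simp add: pos'_def algebra_simps)
      then have "dist (pos' x) (pos w) = t x * d x"
        using t(1)[OF that] by (simp add: dist_norm d_def)
      then show ?thesis using t(2)[OF that] by (simp add: dist_commute)
    qed
    fix \<alpha> assume \<alpha>: "\<alpha> \<in> weights ?V L" and near: "dist (pos w) (comb ?V pos' \<alpha>) \<le> e"
    from \<alpha> obtain A where A: "A \<in> L" "A \<subseteq> ?V" "\<And>v. v \<notin> A \<Longrightarrow> \<alpha> v = 0" "\<And>v. 0 \<le> \<alpha> v" "sum \<alpha> ?V = 1"
      by (rule weightsE) (rule that)
    have finV: "finite ?V" using assms(1) by simp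
    have sumA: "sum \<alpha> A = 1"
      using A(5) sum.mono_neutral_right[OF finV A(2), of \<alpha>] A(3) by simp
    have combA: "comb ?V pos' \<alpha> = comb A pos' \<alpha>"
      by (rule comb_support[OF finV A(2,3)])
    from A(1) consider "A \<in> K" "A \<subseteq> V - {w}" | x where "x \<in> ?R" "A = {x, n x}"
      unfolding L_def by blast
    then show "\<exists>x\<in>?R. \<alpha> = vert_weight x"
    proof cases
      case 1
      have AV: "A \<subseteq> V" using 1 by blast
      have "sum \<alpha> V = 1"
        using sumA sum.mono_neutral_right[OF assms(1) AV, of \<alpha>] A(3) by simp
      then have "\<alpha> \<in> weights V K"
        using A(3,4) AV 1(1) by (intro weightsI[of _ _ A])
      moreover have "\<alpha> w = 0" using A(3) 1(2) by blast
      moreover have "comb A pos' \<alpha> = comb A pos \<alpha>"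
        unfolding comb_def using 1(2) pqr(2) by (intro sum.cong) (auto simp: pos'_def)
      moreover have "comb V pos \<alpha> = comb A pos \<alpha>"
        by (rule comb_support[OF assms(1) AV A(3)])
      ultimately show ?thesis using e(2)[of \<alpha>] near combA by simp
    next
      case (2 x)
      \<comment> \<open>Along the kept piece the distance from \<open>pos w\<close> increases from
        \<open>e\<close> at \<open>x\<close>, so a point within distance \<open>e\<close> has no
        weight at \<open>?y\<close>.\<close>
      let ?y = "n x"
      have y: "?y \<noteq> x" "?y \<notin> ?R" using nW[OF 2(1)] 2(1) by metis+
      have s: "\<alpha> x + \<alpha> ?y = 1" using sumA 2(2) y by simp
      have "comb A pos' \<alpha> = \<alpha> x *\<^sub>R pos' x + \<alpha> ?y *\<^sub>R pos ?y"
        using 2(2) y by (simp add: comb_def pos'_def)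
      then have "comb A pos' \<alpha> - pos w = \<alpha> x *\<^sub>R pos' x + \<alpha> ?y *\<^sub>R pos ?y - (\<alpha> x + \<alpha> ?y) *\<^sub>R pos w"
        by (simp add: s)
      also have "\<dots> = (\<alpha> x * t x + \<alpha> ?y) *\<^sub>R (pos ?y - pos w)"
        using 2(1) by (simp add: pos'_def algebra_simps)
      finally have "dist (comb A pos' \<alpha>) (pos w) = \<bar>\<alpha> x * t x + \<alpha> ?y\<bar> * d x"
        by (simp add: dist_norm d_def)
      then have "(\<alpha> x * t x + \<alpha> ?y) * d x \<le> t x * d x"
        using near combA A(4)[of x] A(4)[of ?y] t[OF 2(1)] by (simp add: dist_commute)
      then have "\<alpha> x * t x + \<alpha> ?y \<le> t x"
        using d[OF 2(1)] e(1) by simp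
      moreover have "\<alpha> x * t x + \<alpha> ?y = t x + \<alpha> ?y * (1 - t x)"
      proof -
        have "\<alpha> x = 1 - \<alpha> ?y" using s by simp
        then show ?thesis by (simp only:) (simp add: algebra_simps)
      qed
      ultimately have "\<alpha> ?y * (1 - t x) \<le> 0" by simp
      then have "\<alpha> ?y = 0"
        using t(1)[OF 2(1)] A(4)[of ?y] by (simp add: mult_le_0_iff)
      then have "\<alpha> = vert_weight x"
        using s A(3) 2(2) by (intro ext) (auto simp: vert_weight_def)
      then show ?thesis using 2(1) by blast
    qed
  qed (use assms(1) in auto)
  moreover have "L = {A \<in> K. A \<subseteq> V - {w}} \<union> {{p, a}, {q, b}, {r, c}}"
    by (simp add: L_def n_simps)
  ultimately show thesis using that by simp
qed

text \<open>The vertex \<open>x\<^sub>0\<close> is drawn at the centroid of the other three. The only affine dependence is then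
  \<open>x\<^sub>1 + x\<^sub>2 + x\<^sub>3 = 3 x\<^sub>0\<close>, and two weights that differ by a multiple of it cannot both omit one
  of \<open>x\<^sub>1\<close>, \<open>x\<^sub>2\<close>, \<open>x\<^sub>3\<close>.\<close>

lemma realises_tetrahedron:
  assumes "distinct [x\<^sub>0, x\<^sub>1, x\<^sub>2, x\<^sub>3]"
  obtains pos where "realises pos {x\<^sub>0, x\<^sub>1, x\<^sub>2, x\<^sub>3} {A. \<not> {x\<^sub>1, x\<^sub>2, x\<^sub>3} \<subseteq> A}"
proof -
  let ?V = "{x\<^sub>0, x\<^sub>1, x\<^sub>2, x\<^sub>3}" and ?K = "{A. \<not> {x\<^sub>1, x\<^sub>2, x\<^sub>3} \<subseteq> A}"
  \<comment> \<open>The positions 1, \<open>\<i>\<close> and \<open>- 1 - \<i>\<close> sum to 0, so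
    their centroid is the position of \<open>x\<^sub>0\<close>.\<close>
  define pos :: "'a \<Rightarrow> complex" where "pos = (\<lambda>x. if x = x\<^sub>0 then 0 else if x = x\<^sub>1 then 1
    else if x = x\<^sub>2 then \<i> else - 1 - \<i>)"
  have "realises pos ?V ?K"
    unfolding realises_def
  proof (rule inj_onI)
    fix \<alpha> \<beta> assume \<alpha>: "\<alpha> \<in> weights ?V ?K" and \<beta>: "\<beta> \<in> weights ?V ?K"
      and eq: "comb ?V pos \<alpha> = comb ?V pos \<beta>"
    have z: "\<gamma> x\<^sub>1 = 0 \<or> \<gamma> x\<^sub>2 = 0 \<or> \<gamma> x\<^sub>3 = 0" and out: "\<And>v. v \<notin> ?V \<Longrightarrow> \<gamma> v = 0"
      and s: "\<gamma> x\<^sub>0 + \<gamma> x\<^sub>1 + \<gamma> x\<^sub>2 + \<gamma> x\<^sub>3 = 1"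
      and c: "comb ?V pos \<gamma> = Complex (\<gamma> x\<^sub>1 - \<gamma> x\<^sub>3) (\<gamma> x\<^sub>2 - \<gamma> x\<^sub>3)"
      if \<gamma>: "\<gamma> \<in> weights ?V ?K" for \<gamma>
    proof -
      from \<gamma> obtain A where A: "A \<in> ?K" "A \<subseteq> ?V" "\<forall>v. v \<notin> A \<longrightarrow> \<gamma> v = 0"
        unfolding weights_def by blast
      then show "\<gamma> x\<^sub>1 = 0 \<or> \<gamma> x\<^sub>2 = 0 \<or> \<gamma> x\<^sub>3 = 0" "\<And>v. v \<notin> ?V \<Longrightarrow> \<gamma> v = 0" by blast+
      show "\<gamma> x\<^sub>0 + \<gamma> x\<^sub>1 + \<gamma> x\<^sub>2 + \<gamma> x\<^sub>3 = 1"
        using weights_sum[OF \<gamma>] assms by (simp add: add.assoc)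
      show "comb ?V pos \<gamma> = Complex (\<gamma> x\<^sub>1 - \<gamma> x\<^sub>3) (\<gamma> x\<^sub>2 - \<gamma> x\<^sub>3)"
        using assms by (auto simp: comb_def pos_def complex_eq_iff)
    qed
    have "\<alpha> x\<^sub>1 - \<alpha> x\<^sub>3 = \<beta> x\<^sub>1 - \<beta> x\<^sub>3" "\<alpha> x\<^sub>2 - \<alpha> x\<^sub>3 = \<beta> x\<^sub>2 - \<beta> x\<^sub>3"
      using eq c[OF \<alpha>] c[OF \<beta>] by simp_all
    moreover from this have "\<alpha> x\<^sub>3 = \<beta> x\<^sub>3"
      using z[OF \<alpha>] z[OF \<beta>] weights_nonneg[OF \<alpha>, of x\<^sub>1] weights_nonneg[OF \<beta>, of x\<^sub>1]
        weights_nonneg[OF \<alpha>, of x\<^sub>2] weights_nonneg[OF \<beta>, of x\<^sub>2]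
        weights_nonneg[OF \<alpha>, of x\<^sub>3] weights_nonneg[OF \<beta>, of x\<^sub>3] by argo
    ultimately have "\<alpha> x\<^sub>0 = \<beta> x\<^sub>0" "\<alpha> x\<^sub>1 = \<beta> x\<^sub>1" "\<alpha> x\<^sub>2 = \<beta> x\<^sub>2" "\<alpha> x\<^sub>3 = \<beta> x\<^sub>3"
      using s[OF \<alpha>] s[OF \<beta>] by linarith+
    then show "\<alpha> = \<beta>"
      using out[OF \<alpha>] out[OF \<beta>] by (intro ext) (metis insertCI insertE singletonD)
  qed
  then show thesis by (rule that)
qed

text \<open>The fourth vertex goes to the centre and \<open>{x, y, z}\<close> becomes the outer
  triangle. The caller chooses the triple, which together with the full tetrahedron is given
  up.\<close>

lemma complete4_realises:
  assumes "complete4 G" "distinct [x, y, z]" "{x, y, z} \<subseteq> verts G"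
  obtains pos where "realises pos (verts G) {A. \<not> {x, y, z} \<subseteq> A}"
proof -
  have card: "card (verts G) = 4" using assms(1) by (simp add: complete4_def)
  then have fin: "finite (verts G)" by (metis card.infinite zero_neq_numeral)
  have "card {x, y, z} < card (verts G)" using assms(2) card by simp
  then have "\<not> verts G \<subseteq> {x, y, z}"
    by (metis card_mono finite.emptyI finite.insertI leD)
  then obtain v where v: "v \<in> verts G" "v \<notin> {x, y, z}" by blast
  have "{v, x, y, z} = verts G"
    using assms(2,3) v card by (intro card_subset_eq[OF fin]) auto
  then show thesis
    using realises_tetrahedron[of v x y z] that assms(2) v by auto
qed

section \<open>Planarity\<close>

definition clique_realisable :: "'a ugraph \<Rightarrow> bool" where
  "clique_realisable G \<longleftrightarrow> (\<exists>pos. realises pos (verts G) (Collect (clique G)))"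

context D3a_reduction
begin

lemma clique_realisable_step:
  assumes "complete4 H \<or> clique_realisable H"
  shows "clique_realisable G"
proof -
  \<comment> \<open>No clique of \<open>G\<close> comes from a triangle at \<open>w\<close>, so only
    the edges at \<open>w\<close> are kept. If \<open>H\<close> is complete, this frees
    \<open>{w, a, b}\<close> to be the outer triangle.\<close>
  define K where "K = {A. clique H A \<and> (w \<in> A \<longrightarrow> A \<subseteq> {w, a} \<or> A \<subseteq> {w, b} \<or> A \<subseteq> {w, c})}"
  have aH: "w \<in> verts H" "{a, b, c} \<subseteq> verts H - {w}"
    using w_neq in_verts notin by (auto simp: verts_H)
  obtain pos where pos: "realises pos (verts H) K"
    using assms
  proof
    assume "complete4 H"
    then obtain pos where *: "realises pos (verts H) {A. \<not> {w, a, b} \<subseteq> A}"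
      by (rule complete4_realises[of H w a b]) (use aH w_neq dist_abc in auto)
    have "A \<in> {A. \<not> {w, a, b} \<subseteq> A}" if "A \<in> K" for A
      using that w_neq dist_abc by (auto simp: K_def)
    then have "realises pos (verts H) K" by (intro realises_mono[OF *]) blast
    then show thesis by (rule that)
  next
    assume "clique_realisable H"
    then obtain pos where *: "realises pos (verts H) (Collect (clique H))"
      unfolding clique_realisable_def by blast
    have "realises pos (verts H) K" by (rule realises_mono[OF *]) (auto simp: K_def)
    then show thesis by (rule that)
  qed
  obtain pos' where *: "realises pos' (verts H - {w} \<union> {p, q, r})
     (insert {p, q, r} ({A \<in> K. A \<subseteq> verts H - {w}} \<union> {{p, a}, {q, b}, {r, c}}))"
  proof (rule realises_truncate[OF _ aH(1) pos _ _ dist_abc aH(2)])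
    show "finite (verts H)" using simple_H by (simp add: simple_graph_def)
    show "distinct [p, q, r]" using distinct_pqr by simp
    show "{p, q, r} \<inter> (verts H - {w}) = {}" by (auto simp: verts_H)
    show "{w, a} \<in> K" "{w, b} \<in> K" "{w, c} \<in> K"
      using clique_edges by (simp_all add: K_def)
  qed
  have "realises pos' (verts G) (Collect (clique G))"
    unfolding verts_G
  proof (rule realises_mono[OF *])
    let ?K' = "insert {p, q, r} ({A \<in> K. A \<subseteq> verts H - {w}} \<union> {{p, a}, {q, b}, {r, c}})"
    fix A assume A: "A \<in> Collect (clique G)" "A \<subseteq> verts H - {w} \<union> {p, q, r}"
    show "\<exists>B\<in>?K'. B \<subseteq> verts H - {w} \<union> {p, q, r} \<and> A \<subseteq> B"
    proof (cases "A \<inter> {p, q, r} = {}")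
      case True
      then have "A \<in> K" "A \<subseteq> verts H - {w}"
        using clique_avoids[of A] A by (auto simp: K_def)
      then show ?thesis using A(2) by (intro bexI[of _ A]) simp_all
    next
      case False
      then have "A \<subseteq> {p, q, r} \<or> A \<subseteq> {p, a} \<or> A \<subseteq> {q, b} \<or> A \<subseteq> {r, c}"
        using clique_meets[of A] A(1) by simp
      moreover have "{p, a} \<subseteq> verts H - {w} \<union> {p, q, r}" "{q, b} \<subseteq> verts H - {w} \<union> {p, q, r}"
        "{r, c} \<subseteq> verts H - {w} \<union> {p, q, r}"
        using aH(2) by auto
      moreover have "{p, q, r} \<in> ?K'" "{p, a} \<in> ?K'" "{q, b} \<in> ?K'" "{r, c} \<in> ?K'"
        by simp_all
      ultimately show ?thesis by (meson sup.cobounded2)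
    qed
  qed
  then show ?thesis unfolding clique_realisable_def by (rule exI[of _ pos'])
qed

end

context D3b_reduction
begin

lemma clique_realisable_step:
  assumes "complete4 H \<or> clique_realisable H"
  shows "clique_realisable G"
proof -
  \<comment> \<open>Of the simplices on the edge \<open>{p, r}\<close> only those in the triangle to
    be cut are kept; the rest contain two vertices no longer adjacent in \<open>G\<close>. If
    \<open>H\<close> is complete, this frees \<open>{p, r, x}\<close> to be the outer
    triangle.\<close>
  define K where "K = {A. clique H A \<and> (p \<in> A \<and> r \<in> A \<longrightarrow> A \<subseteq> {p, r, s})}"
  obtain pos where pos: "realises pos (verts H) K"
    using assms
  proof
    assume "complete4 H"
    obtain x where x: "x \<in> verts G" "x \<notin> {p, q, r, s}"
      by (rule third_neighbour)
    obtain pos where *: "realises pos (verts H) {A. \<not> {p, r, x} \<subseteq> A}"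
      using \<open>complete4 H\<close>
      by (rule complete4_realises[of H p r x]) (use x neqs in_verts in \<open>auto simp: verts_H\<close>)
    have "A \<in> {A. \<not> {p, r, x} \<subseteq> A}" if "A \<in> K" for A
      using that x by (auto simp: K_def)
    then have "realises pos (verts H) K" by (intro realises_mono[OF *]) blast
    then show thesis by (rule that)
  next
    assume "clique_realisable H"
    then obtain pos where *: "realises pos (verts H) (Collect (clique H))"
      unfolding clique_realisable_def by blast
    have "realises pos (verts H) K" by (rule realises_mono[OF *]) (auto simp: K_def)
    then show thesis by (rule that)
  qed
  have "realises (pos(q := midpoint (pos p) (pos r))) (insert q (verts H)) (Collect (clique G))"
  proof (rule realises_bisect[OF _ _ _ _ neqs(3) pos])
    show "finite (verts H)" using simple_H by (simp add: simple_graph_def)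
    show "q \<notin> verts H" "p \<in> verts H" "r \<in> verts H"
      using in_verts neqs by (auto simp: verts_H)
    fix A assume "A \<in> Collect (clique G)"
    then have A: "clique G A" by simp
    show pr: "p \<notin> A \<or> r \<notin> A" using clique_not_pr[OF A] by blast
    show "\<exists>B\<in>K. B \<subseteq> verts H \<and> A \<subseteq> B" if "q \<notin> A"
      using clique_without_q[OF A that] pr by (intro bexI[of _ A]) (auto simp: K_def clique_def)
    show "\<exists>B\<in>K. B \<subseteq> verts H \<and> insert p (insert r (A - {q})) \<subseteq> B" if "q \<in> A"
      using clique_prs clique_with_q[OF A that]
      by (intro bexI[of _ "{p, r, s}"]) (auto simp: K_def clique_def)
  qed
  moreover have "insert q (verts H) = verts G"
    using in_verts by (auto simp: verts_H)
  ultimately show ?thesis unfolding clique_realisable_def by auto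
qed

end

lemma D3_reducible_clique_realisable:
  assumes "simple_graph G" "D3_reducible G"
  shows "complete4 G \<or> clique_realisable G"
  using assms
proof (induction rule: D3_reducible_induct)
  case (step G H)
  from step(2,1) show ?case
    by (rule D3_step_cases)
      (auto intro: D3a_reduction.clique_realisable_step[OF _ step(3)] D3b_reduction.clique_realisable_step[OF _ step(3)])
qed simp

section \<open>From realisations to straight-line drawings\<close>

text \<open>A common point has weights supported on \<open>A\<close> and weights supported on
  \<open>B\<close>; injectivity identifies them, so the support lies in both.\<close>

lemma realises_hull_Int:
  assumes "finite V" "realises pos V K" "A \<in> K" "B \<in> K" "A \<subseteq> V" "B \<subseteq> V"
  shows "convex hull (pos ` A) \<inter> convex hull (pos ` B) \<subseteq> convex hull (pos ` (A \<inter> B))"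
proof
  fix x assume "x \<in> convex hull (pos ` A) \<inter> convex hull (pos ` B)"
  then have "x \<in> comb V pos ` weights V {A}" "x \<in> comb V pos ` weights V {B}"
    using convex_hull_subset_comb[OF assms(1), of _ pos] assms(5,6) by blast+
  then obtain \<alpha> \<beta> where \<alpha>: "\<alpha> \<in> weights V {A}" "x = comb V pos \<alpha>"
    and \<beta>: "\<beta> \<in> weights V {B}" "x = comb V pos \<beta>"
    by auto
  have "\<alpha> \<in> weights V K" "\<beta> \<in> weights V K"
    using \<alpha>(1) \<beta>(1) weights_mono[of "{A}" V K] weights_mono[of "{B}" V K] assms(3,4) by blast+
  then have "\<alpha> = \<beta>" using realisesD[OF assms(2)] \<alpha>(2) \<beta>(2) by simp
  then have "\<forall>v. v \<notin> A \<inter> B \<longrightarrow> \<alpha> v = 0"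
    using \<alpha>(1) \<beta>(1) unfolding weights_def by blast
  then show "x \<in> convex hull (pos ` (A \<inter> B))"
    unfolding \<alpha>(2) using assms(1,5) weights_nonneg[OF \<alpha>(1)] weights_sum[OF \<alpha>(1)]
    by (intro comb_in_convex[of _ V "A \<inter> B"]) (auto simp: hull_subset)
qed

text \<open>Edges are drawn as segments. Every condition on crossings is an instance of the
  intersection of hulls, with vertices treated as singletons.\<close>

lemma planar_if_realises:
  assumes "simple_graph G" and K: "realises pos (verts G) K"
    and sub: "\<And>v. v \<in> verts G \<Longrightarrow> {v} \<in> K" "edges G \<subseteq> K"
  shows "planar G"
proof -
  have fin: "finite (verts G)" and edge: "\<And>e. e \<in> edges G \<Longrightarrow> e \<subseteq> verts G \<and> card e = 2"
    using assms(1) by (auto simp: simple_graph_def)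
  note Int = realises_hull_Int[OF fin K]
  have inj: "inj_on pos (verts G)"
  proof (rule inj_onI, rule ccontr)
    fix u v assume "u \<in> verts G" "v \<in> verts G" "pos u = pos v" "u \<noteq> v"
    then show False using Int[of "{u}" "{v}"] sub(1) by simp
  qed
  have "\<exists>g. arc g \<and> {pathstart g, pathfinish g} = pos ` e \<and> path_image g = convex hull (pos ` e)"
    if e: "e \<in> edges G" for e
  proof -
    obtain u v where uv: "e = {u, v}" "u \<noteq> v" "adj G u v"
      by (rule simple_graph_edgeE[OF assms(1) e])
    then have "pos u \<noteq> pos v"
      using inj simple_graph_adjD[OF assms(1) uv(3)] by (auto dest: inj_onD)
    then show ?thesis
      using uv(1) by (intro exI[of _ "linepath (pos u) (pos v)"]) (simp add: segment_convex_hull)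
  qed
  then obtain \<gamma> where \<gamma>: "\<And>e. e \<in> edges G \<Longrightarrow> arc (\<gamma> e)"
    "\<And>e. e \<in> edges G \<Longrightarrow> {pathstart (\<gamma> e), pathfinish (\<gamma> e)} = pos ` e"
    "\<And>e. e \<in> edges G \<Longrightarrow> path_image (\<gamma> e) = convex hull (pos ` e)"
    by metis
  have "planar_embedding G pos \<gamma>"
    unfolding planar_embedding_def
  proof (intro conjI ballI impI)
    show "inj_on pos (verts G)" by (rule inj)
    show "arc (\<gamma> e)" "{pathstart (\<gamma> e), pathfinish (\<gamma> e)} = pos ` e" if "e \<in> edges G" for e
      using \<gamma> that by auto
    show "v \<in> e" if "e \<in> edges G" "v \<in> verts G" "pos v \<in> path_image (\<gamma> e)" for e v
    proof (rule ccontr)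
      assume "v \<notin> e"
      then show False
        using Int[of "{v}" e] sub(1)[OF that(2)] sub(2) that \<gamma>(3)[OF that(1)] edge[OF that(1)] by auto
    qed
    fix e e' assume e: "e \<in> edges G" "e' \<in> edges G" "e \<noteq> e'"
    obtain u v where uv: "e = {u, v}" by (rule simple_graph_edgeE[OF assms(1) e(1)])
    obtain x y where xy: "e' = {x, y}" by (rule simple_graph_edgeE[OF assms(1) e(2)])
    have "e \<inter> e' = {} \<or> e \<inter> e' = {u} \<or> e \<inter> e' = {v}"
      using e(3) unfolding uv xy by auto
    then have "convex hull (pos ` (e \<inter> e')) = pos ` (e \<inter> e')" by auto
    then show "path_image (\<gamma> e) \<inter> path_image (\<gamma> e') \<subseteq> pos ` (e \<inter> e')"
      using Int[of e e'] sub(2) e edge \<gamma>(3) by (simp add: subset_iff)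
  qed
  then show ?thesis unfolding planar_def by blast
qed

text \<open>A drawing asks only for vertices and edges, so for the complete graph any triple may
  serve as the outer triangle.\<close>

lemma D3_reducible_planar:
  assumes "simple_graph G" "D3_reducible G"
  shows "planar G"
  using D3_reducible_clique_realisable[OF assms]
proof
  assume G: "complete4 G"
  then have "card (verts G) = 4" by (simp add: complete4_def)
  then obtain T where T: "T \<subseteq> verts G" "card T = 3"
    using obtain_subset_with_card_n[of 3 "verts G"] by auto
  then obtain x y z where xyz: "T = {x, y, z}" "distinct [x, y, z]"
    by (auto simp: card_3_iff)
  obtain pos where pos: "realises pos (verts G) {A. \<not> {x, y, z} \<subseteq> A}"
    using complete4_realises[OF G xyz(2)] T(1) xyz(1) by blast
  show ?thesis
  proof (rule planar_if_realises[OF assms(1) pos])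
    show "{v} \<in> {A. \<not> {x, y, z} \<subseteq> A}" for v using xyz(2) by auto
    show "edges G \<subseteq> {A. \<not> {x, y, z} \<subseteq> A}"
    proof clarify
      fix e assume "e \<in> edges G" "{x, y, z} \<subseteq> e"
      then show False
        using xyz T(2) assms(1) card_mono[of e "{x, y, z}"]
        by (auto simp: simple_graph_def dest!: bspec intro: finite_subset)
    qed
  qed
next
  assume "clique_realisable G"
  then obtain pos where pos: "realises pos (verts G) (Collect (clique G))"
    unfolding clique_realisable_def by blast
  show ?thesis
  proof (rule planar_if_realises[OF assms(1) pos])
    show "{v} \<in> Collect (clique G)" if "v \<in> verts G" for v
      using that by (auto simp: clique_def)
    show "edges G \<subseteq> Collect (clique G)"
    proof
      fix e assume "e \<in> edges G"
      then obtain u v where "e = {u, v}" "u \<noteq> v" "adj G u v"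
        by (rule simple_graph_edgeE[OF assms(1)])
      then show "e \<in> Collect (clique G)"
        using simple_graph_adjD[OF assms(1)] by (simp add: clique_def adj_commute)
    qed
  qed
qed

section \<open>Triangular faces\<close>

text \<open>An embedding leaves the direction of \<open>\<gamma>\<close> open; reversing the arc
  where necessary lets arcs be joined.\<close>

lemma planar_embedding_arcE:
  assumes "planar_embedding G pos \<gamma>" "adj G u v"
  obtains g where "arc g" "pathstart g = pos u" "pathfinish g = pos v" "path_image g = path_image (\<gamma> {u, v})"
proof -
  have "arc (\<gamma> {u, v})" "{pathstart (\<gamma> {u, v}), pathfinish (\<gamma> {u, v})} = {pos u, pos v}"
    using assms by (auto simp: planar_embedding_def adj_def)
  then show thesis
    using that[of "\<gamma> {u, v}"] that[of "reversepath (\<gamma> {u, v})"]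
    by (auto simp: doubleton_eq_iff arc_reversepath)
qed

text \<open>A connected set between \<open>U\<close> and \<open>S\<close> cannot reach
  \<open>W\<close>, since the disjoint open sets would separate it.\<close>

lemma component_if_open_complement:
  fixes U W :: "'a::real_normed_vector set"
  assumes "open U" "open W" "U \<inter> W = {}" "connected U" "U \<noteq> {}" "U \<subseteq> S" "S \<subseteq> U \<union> W"
  shows "U \<in> components S"
  unfolding in_components_maximal
proof (intro conjI allI impI)
  fix D assume D: "D \<noteq> {} \<and> U \<subseteq> D \<and> D \<subseteq> S \<and> connected D"
  have "D \<inter> W = {}"
    using connectedD[of D U W] D assms by blast
  then show "D = U" using D assms(7) by blast
qed (use assms in auto)

lemma triangle_is_face_if_connected:
  assumes G: "simple_graph G" and emb: "planar_embedding G pos \<gamma>" and tri: "is_triangle G a b c"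
    and conn: "connected_on G (verts G - {a, b, c})"
  shows "triangle_is_face G pos \<gamma> a b c"
proof -
  define J where "J = path_image (\<gamma> {a, b}) \<union> path_image (\<gamma> {b, c}) \<union> path_image (\<gamma> {a, c})"
  let ?T = "{a, b, c}" and ?S = "verts G - {a, b, c}"
  have abc: "a \<noteq> b" "b \<noteq> c" "a \<noteq> c" and adj: "adj G a b" "adj G b c" "adj G a c" "adj G c a"
    using tri by (auto simp: is_triangle_def adj_commute)
  have edges: "{a, b} \<in> edges G" "{b, c} \<in> edges G" "{a, c} \<in> edges G"
    using adj by (auto simp: adj_def)
  have meet: "path_image (\<gamma> e) \<inter> path_image (\<gamma> e') \<subseteq> pos ` (e \<inter> e')"
    if "e \<in> edges G" "e' \<in> edges G" "e \<noteq> e'" for e e'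
    using emb that by (auto simp: planar_embedding_def)
  have vert: "v \<in> e" if "e \<in> edges G" "v \<in> verts G" "pos v \<in> path_image (\<gamma> e)" for e v
    using emb that by (auto simp: planar_embedding_def)
  obtain g1 where g1: "arc g1" "pathstart g1 = pos a" "pathfinish g1 = pos b" "path_image g1 = path_image (\<gamma> {a, b})"
    by (rule planar_embedding_arcE[OF emb adj(1)])
  obtain g2 where g2: "arc g2" "pathstart g2 = pos b" "pathfinish g2 = pos c" "path_image g2 = path_image (\<gamma> {b, c})"
    by (rule planar_embedding_arcE[OF emb adj(2)])
  obtain g3 where g3: "arc g3" "pathstart g3 = pos c" "pathfinish g3 = pos a" "path_image g3 = path_image (\<gamma> {a, c})"
    using planar_embedding_arcE[OF emb adj(4)] by (metis insert_commute)
  have m: "path_image g1 \<inter> path_image g2 \<subseteq> {pos b}" "path_image g1 \<inter> path_image g3 \<subseteq> {pos a}"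
    "path_image g2 \<inter> path_image g3 \<subseteq> {pos c}"
    using meet[OF edges(1,2)] meet[OF edges(1,3)] meet[OF edges(2,3)] abc g1(4) g2(4) g3(4)
    by (auto simp: doubleton_eq_iff)
  define g where "g = (g1 +++ g2) +++ g3"
  have g12: "arc (g1 +++ g2)" using g1 g2 m(1) by (intro arc_join) auto
  have img12: "path_image (g1 +++ g2) = path_image g1 \<union> path_image g2"
    using g1 g2 by (simp add: path_image_join)
  have "simple_path g"
    unfolding g_def using g12 g1 g2 g3 m img12 by (intro simple_path_join_loop) auto
  moreover have "pathfinish g = pathstart g" using g1 g3 by (simp add: g_def)
  moreover have "path_image g = J"
    using g1 g2 g3 img12 by (simp add: g_def J_def path_image_join)
  ultimately have jordan: "open (inside J)" "connected (inside J)" "inside J \<noteq> {}" "frontier (inside J) = J"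
    "open (outside J)" "connected (outside J)" "outside J \<noteq> {}" "frontier (outside J) = J"
    "inside J \<inter> outside J = {}" "inside J \<union> outside J = - J"
    using Jordan_inside_outside[of g] by auto
  have side: "C \<subseteq> inside J \<or> C \<subseteq> outside J" if "connected C" "C \<inter> J = {}" for C
    using connectedD[OF that(1) jordan(1,5)] jordan(9,10) that(2) by blast
  \<comment> \<open>An edge that leaves the triangle differs from its three sides, so it can touch
    the curve only in a shared corner.\<close>
  have Jmeet: "x \<in> pos ` (e \<inter> ?T)" if "e \<in> edges G" "\<not> e \<subseteq> ?T" "x \<in> path_image (\<gamma> e)" "x \<in> J" for e x
  proof -
    have "e \<noteq> {a, b}" "e \<noteq> {b, c}" "e \<noteq> {a, c}" using that(2) by auto
    then show ?thesis
      using meet[OF that(1) edges(1)] meet[OF that(1) edges(2)] meet[OF that(1) edges(3)] that(3,4)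
      unfolding J_def by blast
  qed
  have notJ: "pos v \<notin> J" if "v \<in> ?S" for v
    using vert[OF edges(1), of v] vert[OF edges(2), of v] vert[OF edges(3), of v] that
    by (auto simp: J_def)
  have posJ: "pos v \<in> J" if "v \<in> ?T" for v
    using that g1(2-4) g2(2-4) pathstart_in_path_image[of g1] pathfinish_in_path_image[of g1]
      pathfinish_in_path_image[of g2] by (auto simp: J_def)
  \<comment> \<open>The side of the curve is a two-colouring of the remaining vertices, constant
    along edges.\<close>
  have same: "(pos u \<in> inside J) = (pos v \<in> inside J)" if "u \<in> ?S" "v \<in> ?S" for u v
  proof (rule connected_onD[where P = "\<lambda>v. pos v \<in> inside J", OF conn _ that])
    fix u v assume uv: "u \<in> ?S" "v \<in> ?S" "adj G u v"
    obtain h where h: "arc h" "pathstart h = pos u" "pathfinish h = pos v" "path_image h = path_image (\<gamma> {u, v})"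
      by (rule planar_embedding_arcE[OF emb uv(3)])
    have "path_image h \<inter> J = {}"
      using Jmeet[of "{u, v}"] uv h(4) by (auto simp: adj_def)
    then have "path_image h \<subseteq> inside J \<or> path_image h \<subseteq> outside J"
      using side h(1) by (simp add: arc_imp_path connected_path_image)
    moreover have "pos u \<in> path_image h" "pos v \<in> path_image h"
      using h(2,3) pathstart_in_path_image[of h] pathfinish_in_path_image[of h] by auto
    ultimately show "(pos u \<in> inside J) = (pos v \<in> inside J)"
      using jordan(9) by blast
  qed
  \<comment> \<open>\<open>X\<close> is the side that holds the remaining vertices and
    \<open>Y\<close> is the future face. Naming them treats inside and outside alike from here
    on.\<close>
  obtain X Y where XY: "open X" "open Y" "X \<inter> Y = {}" "X \<union> Y = - J" "connected Y" "Y \<noteq> {}" "frontier Y = J"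
    and SX: "\<And>v. v \<in> ?S \<Longrightarrow> pos v \<in> X"
    and sideX: "\<And>C. connected C \<Longrightarrow> C \<inter> J = {} \<Longrightarrow> C \<inter> X \<noteq> {} \<Longrightarrow> C \<subseteq> X"
  proof (cases "\<exists>v\<in>?S. pos v \<in> inside J")
    case True
    then have "pos v \<in> inside J" if "v \<in> ?S" for v using same that by blast
    then show thesis
      using side jordan(9) by (intro that[OF jordan(1,5,9,10,6,7,8)]) blast+
  next
    case False
    then have "pos v \<in> outside J" if "v \<in> ?S" for v
      using notJ[OF that] that jordan(10) by blast
    moreover have "outside J \<inter> inside J = {}" "outside J \<union> inside J = - J"
      using jordan(9,10) by blast+
    ultimately show thesis
      using side by (intro that[OF jordan(5,1) _ _ jordan(2,3,4)]) blast+
  qed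
  have edgeX: "path_image (\<gamma> e) \<subseteq> J \<union> X" if e: "e \<in> edges G" for e
  proof (cases "e \<subseteq> ?T")
    case True
    obtain u v where "e = {u, v}" "u \<noteq> v" by (rule simple_graph_edgeE[OF G e])
    then have "e = {a, b} \<or> e = {b, c} \<or> e = {a, c}" using True by auto
    then show ?thesis by (auto simp: J_def)
  next
    case False
    obtain x y where xy: "e = {x, y}" "adj G x y"
      by (rule simple_graph_edgeE[OF G e])
    obtain u v where uv: "e = {u, v}" "adj G u v" "v \<notin> ?T"
    proof (cases "y \<in> ?T")
      case True
      then show thesis using that[of y x] xy False by (simp add: adj_commute insert_commute)
    qed (use that[of x y] xy in blast)
    have vS: "v \<in> ?S" "u \<in> verts G" using simple_graph_adjD[OF G uv(2)] uv(3) by auto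
    obtain h where h: "arc h" "pathstart h = pos u" "pathfinish h = pos v" "path_image h = path_image (\<gamma> {u, v})"
      by (rule planar_embedding_arcE[OF emb uv(2)])
    \<comment> \<open>The start \<open>u\<close> may be a corner on \<open>J\<close> and is left
      out. The rest of the arc is connected, misses \<open>J\<close> because the arc is injective,
      and ends at \<open>v\<close> in \<open>X\<close>, so it lies in \<open>X\<close>.\<close>
    let ?C = "h ` {0<..1}"
    have sub: "?C \<subseteq> path_image h" by (auto simp: path_image_def)
    have "continuous_on {0<..1} h"
      using h(1) by (auto simp: arc_def path_def intro: continuous_on_subset)
    then have "connected ?C" by (intro connected_continuous_image) auto
    moreover have "?C \<inter> J = {}"
    proof (rule ccontr)
      assume "?C \<inter> J \<noteq> {}"
      then obtain t where t: "0 < t" "t \<le> 1" "h t \<in> J" by auto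
      then have "h t \<in> pos ` (e \<inter> ?T)"
        using Jmeet[OF e False, of "h t"] subsetD[OF sub, of "h t"] h(4) uv(1) by simp
      then have "h t = h 0" using uv(1,3) h(2) by (auto simp: pathstart_def)
      then show False using h(1) t by (auto simp: arc_def dest: inj_onD)
    qed
    moreover have "?C \<inter> X \<noteq> {}"
    proof -
      have "h 1 \<in> X" using SX[OF vS(1)] h(3) by (simp add: pathfinish_def)
      moreover have "h 1 \<in> ?C" by simp
      ultimately show ?thesis by blast
    qed
    ultimately have "?C \<subseteq> X" by (rule sideX)
    moreover have "path_image h = insert (h 0) ?C"
    proof -
      have "{0..1} = insert 0 {0<..1::real}" by auto
      then show ?thesis by (simp add: path_image_def)
    qed
    moreover have "h 0 \<in> J \<union> X"
      using SX[of u] posJ[of u] vS(2) h(2) by (auto simp: pathstart_def)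
    ultimately show ?thesis using h(4) uv(1) by auto
  qed
  have DX: "drawing G pos \<gamma> \<subseteq> J \<union> X"
    using SX posJ edgeX unfolding drawing_def by blast
  have JD: "J \<subseteq> drawing G pos \<gamma>"
    using edges unfolding drawing_def J_def by blast
  have "Y \<in> components (- drawing G pos \<gamma>)"
  proof (rule component_if_open_complement[OF XY(2,1) _ XY(5,6)])
    show "Y \<inter> X = {}" using XY(3) by blast
    show "Y \<subseteq> - drawing G pos \<gamma>" using DX XY(3,4) by blast
    show "- drawing G pos \<gamma> \<subseteq> Y \<union> X" using JD XY(4) by blast
  qed
  then show ?thesis
    using XY(7) unfolding triangle_is_face_def faces_def J_def by blast
qed

theorem theorem6:
  fixes G :: "'a ugraph"
  assumes "simple_graph G" and "D3_reducible G"
  shows "planar G \<and>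
    (\<forall>pos \<gamma>. planar_embedding G pos \<gamma> \<longrightarrow>
       (\<forall>a b c. is_triangle G a b c \<longrightarrow> triangle_is_face G pos \<gamma> a b c))"
proof (intro conjI allI impI)
  show "planar G" by (rule D3_reducible_planar[OF assms])
  fix pos \<gamma> a b c
  assume emb: "planar_embedding G pos \<gamma>" and tri: "is_triangle G a b c"
  then have "clique G {a, b, c}"
    using simple_graph_adjD[OF assms(1)] by (auto simp: is_triangle_def clique_def adj_commute)
  then have "connected_on G (verts G - {a, b, c})"
    using D3_reducible_clique_connected[OF assms] by (simp add: clique_connected_def)
  then show "triangle_is_face G pos \<gamma> a b c"
    by (rule triangle_is_face_if_connected[OF assms(1) emb tri])
qed

end
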